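(* The recursive tree process $(\tau_{\mathbf i},X_{\mathbf i})_{\mathbf i\in\mathbb T}$ corresponding to the map $\gamma:[0,1]\times I^2\to I$, $$\gamma[t](x,y):=\begin{cases}x\wedge y&\text{if }x\wedge y>t,\\ \infty&\text{otherwise,}\end{cases}$$ where $I:=[0,1]\cup\{\infty\}$, and the law $\nu$ on $I$ defined by $\nu\big((t,1]\cup\{\infty\}\big):=1\wedge\frac1{2t}$ $(t\in[0,1])$, is nonendogenous; that is, $X_\varnothing$ is not measurable with respect to the $\sigma$-field generated by $(\tau_{\mathbf i})_{\mathbf i\in\mathbb T}$.
   Context: $\mathbb T$ is the set of all finite words over the alphabet $\{1,2\}$, with $\varnothing$ the empty word. A rooted subtree is a set $\mathbb U\subset\mathbb T$ closed under taking prefixes; its boundary is $\partial\mathbb U:=\{i_1\cdots i_n\in\mathbb T\setminus\mathbb U: n\ge1,\ i_1\cdots i_{n-1}\in\mathbb U\}$ if $\mathbb U\ne\emptyset$, and $\partial\emptyset:=\{\varnothing\}$. It is known that $\nu$ solves the recursive distributional equation: if $X_1,X_2$ are independent with law $\nu$ and independent of $\tau$ uniform on $[0,1]$, then $\gamma[\tau](X_1,X_2)$ has law $\nu$. The recursive tree process (RTP) corresponding to $\gamma$ and $\nu$ is the collection of random variables $(\tau_{\mathbf i},X_{\mathbf i})_{\mathbf i\in\mathbb T}$, unique in law, such that $(\tau_{\mathbf i})_{\mathbf i\in\mathbb T}$ are i.i.d. uniform on $[0,1]$; for each finite rooted subtree $\mathbb U$, the variables $(X_{\mathbf i})_{\mathbf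 i\in\partial\mathbb U}$ are i.i.d. with law $\nu$ and independent of $(\tau_{\mathbf i})_{\mathbf i\in\mathbb U}$; and $X_{\mathbf i}=\gamma[\tau_{\mathbf i}](X_{\mathbf i1},X_{\mathbf i2})$ for all $\mathbf i\in\mathbb T$. The RTP is endogenous if $X_\varnothing$ is measurable with respect to the $\sigma$-field generated by $(\tau_{\mathbf i})_{\mathbf i\in\mathbb T}$ (i.e. a.s. equal to a measurable function of $(\tau_{\mathbf i})_{\mathbf i\in\mathbb T}$), and nonendogenous otherwise. *)

theory Defs
  imports "HOL-Probability.Probability" "HOL-Library.Sublist"
begin

datatype letter = Letter1 | Letter2

instance letter :: countable
  by countable_datatype

type_synonym word = "letter list"

definition rooted_subtree :: "word set \<Rightarrow> bool" where
  "rooted_subtree U \<longleftrightarrow> (\<forall>w\<in>U. \<forall>v. prefix v w \<longrightarrow> v \<in> U)"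

definition boundary :: "word set \<Rightarrow> word set" where
  "boundary U =
     (if U = {} then {[]} else {w @ [a] | w a. w \<in> U \<and> w @ [a] \<notin> U})"

definition unit_space :: "real measure" where
  "unit_space = restrict_space borel {0..1}"

definition uniform01 :: "real measure" where
  "uniform01 = restrict_space lborel {0..1}"

definition I_set :: "ereal set" where
  "I_set = {0..1} \<union> {\<infinity>}"

definition I_space :: "ereal measure" where
  "I_space = restrict_space borel I_set"

definition gamma :: "real \<Rightarrow> ereal \<Rightarrow> ereal \<Rightarrow> ereal" where
  "gamma t x y = (if min x y > ereal t then min x y else \<infinity>)"

text \<open>
  The quotient is taken in \<^typ>\<open>ennreal\<close>, where \<open>1 / 0 = \<infinity>\<close>, so that the tail at \<open>t = 0\<close> is \<open>1\<close>.
  It has to be required separately that the total mass is \<open>1\<close>: the tails do not see the point \<open>0\<close>.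
\<close>

definition has_nu_tails :: "ereal measure \<Rightarrow> bool" where
  "has_nu_tails N \<longleftrightarrow>
     sets N = sets I_space \<and> prob_space N \<and>
     (\<forall>t\<in>{0..1::real}. emeasure N ({ereal t<..1} \<union> {\<infinity>}) = min 1 (1 / (2 * ennreal t)))"

definition nu :: "ereal measure" where
  "nu = (THE N. has_nu_tails N)"

lemma space_I_space: "space I_space = I_set"
  by (simp add: I_space_def space_restrict_space)

lemma I_borel: "I_set \<in> sets borel"
  by (simp add: I_set_def)

lemma sets_I_space_iff: "A \<in> sets I_space \<longleftrightarrow> A \<in> sets borel \<and> A \<subseteq> I_set"
  unfolding I_space_def using sets_restrict_space_iff[of I_set borel A] I_borel by auto

lemma I_set_tail:
  assumes "0 \<le> t"
  shows "{ereal t<..1} \<union> {\<infinity>} = {ereal t<..} \<inter> I_set"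
proof (rule set_eqI)
  fix x :: ereal
  show "x \<in> {ereal t<..1} \<union> {\<infinity>} \<longleftrightarrow> x \<in> {ereal t<..} \<inter> I_set"
    using assms by (cases x) (auto simp: I_set_def)
qed

lemma tail_sets: "0 \<le> t \<Longrightarrow> {ereal t<..1} \<union> {\<infinity>} \<in> sets I_space"
  unfolding I_set_tail sets_I_space_iff using I_borel by auto

lemma has_nu_tails_exists: "\<exists>N. has_nu_tails N"
proof -
  define f :: "real \<Rightarrow> ereal" where "f = (\<lambda>u. if u \<le> 1/2 then \<infinity> else ereal (1 / (2 * u)))"
  have fb: "f \<in> borel_measurable borel"
    unfolding f_def by measurable
  have fI: "f u \<in> I_set" if "u \<in> {0..1}" for u
    using that by (auto simp: f_def I_set_def field_simps)
  have fm: "f \<in> uniform01 \<rightarrow>\<^sub>M I_space"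
    unfolding uniform01_def I_space_def
    by (rule measurable_restrict_space3) (use fb fI in auto)
  have inv: "1 / (2 * ennreal t) = ennreal (1 / (2 * t))" if "0 < t" for t
  proof -
    have "2 * ennreal t = ennreal (2 * t)"
      using that ennreal_mult[of 2 t] by simp
    thus ?thesis using that divide_ennreal[of 1 "2 * t"] by (simp only: ennreal_1)
  qed
  interpret U: prob_space uniform01
    by (rule prob_spaceI) (simp add: uniform01_def space_restrict_space emeasure_restrict_space)
  have "emeasure (distr uniform01 I_space f) ({ereal t<..1} \<union> {\<infinity>}) = min 1 (1 / (2 * ennreal t))"
    if t: "t \<in> {0..1}" for t
  proof -
    have "emeasure (distr uniform01 I_space f) ({ereal t<..1} \<union> {\<infinity>})
        = emeasure uniform01 (f -` ({ereal t<..1} \<union> {\<infinity>}) \<inter> space uniform01)"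
      using t by (intro emeasure_distr fm tail_sets) auto
    also have "\<dots> = emeasure lborel (f -` ({ereal t<..1} \<union> {\<infinity>}) \<inter> {0..1})"
      by (simp add: uniform01_def space_restrict_space emeasure_restrict_space)
    also have "\<dots> = min 1 (1 / (2 * ennreal t))"
    proof (cases "t < 1/2")
      case True
      have "f -` ({ereal t<..1} \<union> {\<infinity>}) \<inter> {0..1} = {0..1}"
      proof (intro equalityI subsetI IntI vimageI2)
        fix u :: real assume u: "u \<in> {0..1}"
        have "t < 1 / (2 * u)" if "u > 1/2"
        proof -
          have "2 * u * t \<le> 2 * 1 * t" using u t by (intro mult_right_mono) auto
          thus ?thesis using that True by (simp add: field_simps)
        qed
        thus "f u \<in> {ereal t<..1} \<union> {\<infinity>}" using u
          by (auto simp: f_def field_simps)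
      qed auto
      moreover have "1 \<le> 1 / (2 * ennreal t)"
      proof (cases "t = 0")
        case True thus ?thesis by (simp add: divide_ennreal_def)
      next
        case False
        hence "1 / (2 * ennreal t) = ennreal (1 / (2 * t))"
          using t by (intro inv) auto
        moreover have "1 \<le> 1 / (2 * t)" using True False t by (simp add: field_simps)
        ultimately show ?thesis by (simp add: ennreal_ge_1)
      qed
      ultimately show ?thesis by (simp add: min_absorb1)
    next
      case False
      have "f -` ({ereal t<..1} \<union> {\<infinity>}) \<inter> {0..1} = {0..<1 / (2 * t)} \<union> {0..1/2}"
      proof (rule set_eqI)
        fix u :: real
        have "1 / (2 * t) \<le> 1" using False by (simp add: field_simps)
        hence le: "u \<le> 1" if "u < 1 / (2 * t)" using that by linarith
        have "t < 1 / (2 * u) \<longleftrightarrow> u < 1 / (2 * t)" if "u > 1/2"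
          using False that by (simp add: field_simps)
        moreover have "1 / (2 * u) \<le> 1" if "u > 1/2"
          using that by (simp add: field_simps)
        ultimately have "u \<in> f -` ({ereal t<..1} \<union> {\<infinity>}) \<longleftrightarrow> u \<le> 1/2 \<or> u < 1 / (2 * t)"
          by (cases "u \<le> 1/2") (simp_all add: f_def one_ereal_def)
        thus "u \<in> f -` ({ereal t<..1} \<union> {\<infinity>}) \<inter> {0..1} \<longleftrightarrow> u \<in> {0..<1 / (2 * t)} \<union> {0..1/2}"
          using le by auto
      qed
      also have "emeasure lborel \<dots> = ennreal (1 / (2 * t))"
      proof (cases "t = 1")
        case True
        hence "{0..<1 / (2 * t)} \<union> {0..1/2} = {0..1/2}" by auto
        with True show ?thesis by simp
      next
        case F: False
        hence "1 / 2 < 1 / (2 * t)" using False t by (simp add: field_simps)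
        hence "{0..<1 / (2 * t)} \<union> {0..1/2} = {0..<1 / (2 * t)}" by auto
        thus ?thesis using t by simp
      qed
      also have "\<dots> = min 1 (1 / (2 * ennreal t))"
      proof -
        have "ennreal (1 / (2 * t)) \<le> 1" using False t by (simp add: field_simps)
        moreover have "1 / (2 * ennreal t) = ennreal (1 / (2 * t))" using False t by (intro inv) auto
        ultimately show ?thesis by (simp only: min.absorb2)
      qed
      finally show ?thesis .
    qed
    finally show ?thesis .
  qed
  hence "has_nu_tails (distr uniform01 I_space f)"
    unfolding has_nu_tails_def using U.prob_space_distr[OF fm] by auto
  thus ?thesis ..
qed

lemma has_nu_tails_unique:
  assumes N: "has_nu_tails N" and N': "has_nu_tails N'"
  shows "N = N'"
proof -
  interpret N: prob_space N using N by (simp add: has_nu_tails_def)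
  interpret N': prob_space N' using N' by (simp add: has_nu_tails_def)
  have sN: "sets N = sets I_space" and sN': "sets N' = sets I_space"
    using N N' by (simp_all add: has_nu_tails_def)
  hence spN: "space N = I_set" and spN': "space N' = I_set"
    using sets_eq_imp_space_eq space_I_space by blast+
  have mN: "id \<in> N \<rightarrow>\<^sub>M borel" and mN': "id \<in> N' \<rightarrow>\<^sub>M borel"
    unfolding measurable_cong_sets[OF sN refl] measurable_cong_sets[OF sN' refl] I_space_def
    by (auto intro: measurable_restrict_space1)
  have tails_eq: "emeasure N ({ereal t<..1} \<union> {\<infinity>}) = emeasure N' ({ereal t<..1} \<union> {\<infinity>})"
    if "t \<in> {0..1}" for t
    using N N' that unfolding has_nu_tails_def by (metis (no_types, lifting))
  define E :: "ereal set set" where "E = insert UNIV (range greaterThan)"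
  have eq: "emeasure N (A \<inter> I_set) = emeasure N' (A \<inter> I_set)" if "A \<in> E" for A
  proof -
    from that consider "A = UNIV" | a where "A = {a<..}" by (auto simp: E_def)
    thus ?thesis
    proof cases
      case 1
      thus ?thesis using N.emeasure_space_1 N'.emeasure_space_1 spN spN' by simp
    next
      case (2 a)
      consider "a < 0" | t where "t \<in> {0..1}" "a = ereal t" | "a > 1" "a \<noteq> \<infinity>" | "a = \<infinity>"
        by (cases a) (auto simp: not_less one_ereal_def, force)
      thus ?thesis
      proof cases
        case 1
        hence "A \<inter> I_set = I_set" using 2 by (auto simp: I_set_def)
        thus ?thesis using N.emeasure_space_1 N'.emeasure_space_1 spN spN' by simp
      next
        case (2 t)
        hence "A \<inter> I_set = {ereal t<..1} \<union> {\<infinity>}"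
          using \<open>A = {a<..}\<close> I_set_tail[of t] by simp
        thus ?thesis using tails_eq[OF 2(1)] by simp
      next
        case 3
        hence "A \<inter> I_set = {ereal 1<..1} \<union> {\<infinity>}"
          using \<open>A = {a<..}\<close> by (auto simp: I_set_def)
        thus ?thesis using tails_eq[of 1] by simp
      next
        case 4
        hence "A \<inter> I_set = {}" using \<open>A = {a<..}\<close> by auto
        thus ?thesis by simp
      qed
    qed
  qed
  have sE: "sets borel = sigma_sets UNIV E"
  proof -
    have "sigma_sets UNIV E = sigma_sets UNIV (range greaterThan)"
      unfolding E_def by (intro sigma_sets_eqI) (auto intro: sigma_sets_top sigma_sets.Basic)
    thus ?thesis by (simp add: borel_Ioi)
  qed
  have "distr N borel id = distr N' borel id"
  proof (rule measure_eqI_generator_eq[where E = E and \<Omega> = UNIV and A = "\<lambda>_. UNIV"])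
    have Int_greaterThan: "{a<..} \<inter> {b<..} \<in> range greaterThan" for a b :: ereal
      by (rule range_eqI[of _ _ "max a b"]) auto
    show "Int_stable E"
    proof (rule Int_stableI)
      fix A B assume "A \<in> E" "B \<in> E"
      thus "A \<inter> B \<in> E" 
        using Int_greaterThan by (auto simp: E_def)
    qed
    show "emeasure (distr N borel id) A = emeasure (distr N' borel id) A" if "A \<in> E" for A
    proof -
      have "A \<in> sets borel" using that sE by (auto intro: sigma_sets.Basic)
      thus ?thesis using eq[OF that] by (simp add: emeasure_distr mN mN' spN spN')
    qed
    show "emeasure (distr N borel id) UNIV \<noteq> \<infinity>" for i :: nat
      using N.emeasure_space_1 by (simp add: emeasure_distr mN spN)
  qed (auto simp: sE E_def)
  hence *: "emeasure (distr N borel id) A = emeasure (distr N' borel id) A" for A by simp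
  show ?thesis
  proof (rule measure_eqI)
    fix A assume "A \<in> sets N"
    hence "A \<in> sets borel" "A \<inter> I_set = A" by (auto simp: sN sets_I_space_iff)
    thus "emeasure N A = emeasure N' A"
      using *[of A] by (simp add: emeasure_distr mN mN' spN spN')
  qed (simp add: sN sN')
qed

lemma has_nu_tails_nu: "has_nu_tails nu"
  unfolding nu_def using has_nu_tails_exists has_nu_tails_unique by (metis theI)

text \<open>
  Joint independence of the two vectors is stated for the sigma-algebras they generate, because
  \<^const>\<open>prob_space.indep_var\<close> requires both vectors to take values in the same type.
  As usual for random variables, the recursion holds almost surely.
\<close>

definition recursive_tree_process ::
  "'a measure \<Rightarrow> (real \<Rightarrow> ereal \<Rightarrow> ereal \<Rightarrow> ereal) \<Rightarrow> ereal measure \<Rightarrow>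
   (word \<Rightarrow> 'a \<Rightarrow> real) \<Rightarrow> (word \<Rightarrow> 'a \<Rightarrow> ereal) \<Rightarrow> bool" where
  "recursive_tree_process M g N \<tau> X \<longleftrightarrow>
     prob_space M \<and>
     (\<forall>i. \<tau> i \<in> M \<rightarrow>\<^sub>M unit_space) \<and>
     (\<forall>i. X i \<in> M \<rightarrow>\<^sub>M I_space) \<and>
     prob_space.indep_vars M (\<lambda>_. unit_space) \<tau> UNIV \<and>
     (\<forall>i. distr M unit_space (\<tau> i) = uniform01) \<and>
     (\<forall>U. finite U \<and> rooted_subtree U \<longrightarrow>
        prob_space.indep_vars M (\<lambda>_. I_space) X (boundary U) \<and>
        (\<forall>i\<in>boundary U. distr M I_space (X i) = N) \<and>
        prob_space.indep_set M
          (sets (vimage_algebra (space M) (\<lambda>\<omega>. \<lambda>i\<in>boundary U. X i \<omega>)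
                   (\<Pi>\<^sub>M i\<in>boundary U. I_space)))
          (sets (vimage_algebra (space M) (\<lambda>\<omega>. \<lambda>i\<in>U. \<tau> i \<omega>)
                   (\<Pi>\<^sub>M i\<in>U. unit_space)))) \<and>
     (\<forall>i. AE \<omega> in M. X i \<omega> = g (\<tau> i \<omega>) (X (i @ [Letter1]) \<omega>) (X (i @ [Letter2]) \<omega>))"

text \<open>Measurability of the root variable is understood up to null sets.\<close>

definition endogenous ::
  "'a measure \<Rightarrow> (word \<Rightarrow> 'a \<Rightarrow> real) \<Rightarrow> (word \<Rightarrow> 'a \<Rightarrow> ereal) \<Rightarrow> bool" where
  "endogenous M \<tau> X \<longleftrightarrow>
     (\<exists>F \<in> (\<Pi>\<^sub>M i\<in>UNIV. unit_space) \<rightarrow>\<^sub>M I_space. AE \<omega> in M. X [] \<omega> = F (\<lambda>i. \<tau> i \<omega>))"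

end

theory Submission
  imports Defs
begin

text \<open>
  If the process were endogenous, then any two solutions of the recursion that are driven by the same
  \<open>\<tau>\<close> would have to agree at the root. Hence it suffices to find a law on pairs, with both marginals
  equal to \<open>\<nu>\<close>, that is invariant under the recursion applied to both coordinates with a common
  \<open>\<tau>\<close> and that is not concentrated on the diagonal.

  In the coordinate \<open>a = 2 - 1/s\<close> the finite part of \<open>\<nu>\<close> is half of the uniform law on \<open>[0,1]\<close>. If the
  law of \<open>(X, Y)\<close> is symmetric without mass on the diagonal and \<open>u(a, b) = P(X > a, Y \<le> b)\<close> for
  \<open>a \<le> b\<close>, then invariance becomes \<open>2 u u\<^sub>a + u = h(a)\<close>, where \<open>h\<close> is determined by the values of
  \<open>u\<close> on the diagonal. This equation is homogeneous. The ansatz \<open>u(a, b) = b \<phi>(a/b)\<close>, \<open>h(a) = \<kappa> a\<close>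
  gives \<open>2 \<phi> \<phi>' = \<kappa> r - \<phi>\<close> with \<open>\<phi>(0) = 1/2\<close>, \<open>\<phi>(1) = c\<close> and \<open>\<kappa> = c/2 + c\<^sup>2\<close>.
  The diagonal law corresponds to \<open>c = 0\<close>, but there is also a solution with \<open>0 < c \<le> 1/2\<close>, and
  \<open>c\<close> is the probability that \<open>X = \<infinity>\<close> while \<open>Y\<close> is finite.
\<close>

subsection \<open>A solution of the boundary value problem\<close>

text \<open>The space that carries the given process need not support a second solution, so the
  comparison passes through finite trees. If the root were a function of all \<tau>, the event that
  it is \<infinity> would be approximated within c/2 by an event B reading \<tau> on finitely many
  levels. The probability of a mismatch between the root and B depends only on the joint law of
  \<tau> on these levels and of the independent \<nu>-values on the level below. Either coordinate
  of a coupled tree has this same law, and both coordinates face the same B. One coordinate is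
  \<infinity> while the other is finite with probability c, so the two mismatch probabilities add up
  to at least c, a contradiction. Invariance of the coupling is what prevents this discrepancy from
  fading with the depth. As every depth is finite, independent pairs on a product space suffice, and
  no infinite coupled process has to be constructed.\<close>

lemma root_equation:
  "\<exists>\<delta>::real. 3/5 \<le> \<delta> \<and> \<delta> \<le> 24/25 \<and>
     \<delta> * ln ((sqrt (2 - \<delta>\<^sup>2) + 1) / sqrt (1 - \<delta>\<^sup>2)) = ln (2 * \<delta> / sqrt (1 - \<delta>\<^sup>2))"
proof -
  \<comment> \<open>\<open>G\<close> tends to 0 as \<delta> tends to 1, which is the degenerate
    solution c = 0. A sign change on an interval ending strictly below 1 yields a root away from
    it.\<close>
  define G :: "real \<Rightarrow> real" where
    "G = (\<lambda>\<delta>. ln (2 * \<delta> / sqrt (1 - \<delta>\<^sup>2)) - \<delta> * ln ((sqrt (2 - \<delta>\<^sup>2) + 1) / sqrt (1 - \<delta>\<^sup>2)))"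
  have sq: "0 < 1 - x\<^sup>2" if "3/5 \<le> x" "x \<le> 24/25" for x :: real
  proof -
    have "x\<^sup>2 \<le> (24/25)\<^sup>2" using that by (intro power_mono) auto
    thus ?thesis by (simp add: power2_eq_square)
  qed
  have cont: "continuous_on {3/5..24/25} G"
    unfolding G_def
  proof (intro continuous_intros ballI)
    fix x :: real assume x: "x \<in> {3/5..24/25}"
    show "sqrt (1 - x\<^sup>2) \<noteq> 0" using sq[of x] x by simp
    show "sqrt (1 - x\<^sup>2) \<noteq> 0" using sq[of x] x by simp
    show "2 * x / sqrt (1 - x\<^sup>2) \<noteq> 0" using sq[of x] x by simp
    have "sqrt (2 - x\<^sup>2) + 1 > 0" using sq[of x] x by (intro add_nonneg_pos) auto
    thus "(sqrt (2 - x\<^sup>2) + 1) / sqrt (1 - x\<^sup>2) \<noteq> 0" using sq[of x] x by simp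
  qed
  \<comment> \<open>The endpoints come from the Pythagorean triples (3,4,5) and (7,24,25), which
    make the root of 1 - \<delta>^2 rational. Clearing denominators turns the two signs into
    comparisons of rational powers, with exponents 5 and 3 here and 25 and 24 at the other
    end.\<close>
  have "G (3/5) \<le> 0"
  proof -
    have s1: "sqrt (1 - (3/5)\<^sup>2) = (4/5 :: real)" by (rule real_sqrt_unique) (auto simp: power2_eq_square)
    have "(1.28::real) \<le> sqrt (2 - (3/5)\<^sup>2)" by (rule real_le_rsqrt) (simp add: power2_eq_square)
    hence m: "(2.85::real) \<le> (sqrt (2 - (3/5)\<^sup>2) + 1) / (4/5)" by simp
    have "5 * ln (3/2::real) = ln ((3/2)^5)" by (subst ln_realpow) auto
    also have "\<dots> \<le> ln (2.85 ^ 3)" by (subst ln_le_cancel_iff) (auto simp: field_simps)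
    also have "\<dots> = 3 * ln 2.85" by (subst ln_realpow) auto
    also have "\<dots> \<le> 3 * ln ((sqrt (2 - (3/5)\<^sup>2) + 1) / (4/5))" using m by simp
    finally show ?thesis unfolding G_def s1 by simp
  qed
  moreover have "0 \<le> G (24/25)"
  proof -
    have s1: "sqrt (1 - (24/25)\<^sup>2) = (7/25 :: real)" by (rule real_sqrt_unique) (auto simp: power2_eq_square)
    have "sqrt (2 - (24/25)\<^sup>2) \<le> (1.0385::real)" by (rule real_le_lsqrt) (auto simp: power2_eq_square)
    hence m: "(sqrt (2 - (24/25)\<^sup>2) + 1) / (7/25) \<le> (7.2804::real)" by simp
    have p: "0 < (sqrt (2 - (24/25)\<^sup>2) + 1) / (7/25 :: real)"
      by (intro divide_pos_pos add_nonneg_pos) (auto simp: power2_eq_square)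
    have "24 * ln ((sqrt (2 - (24/25)\<^sup>2) + 1) / (7/25)) \<le> 24 * ln (7.2804::real)"
      using m p by (simp del: divide_divide_eq_right)
    also have "\<dots> = ln (7.2804 ^ 24)" by (subst ln_realpow) auto
    also have "\<dots> \<le> ln ((48/7)^25)" by (subst ln_le_cancel_iff) (auto simp: field_simps)
    also have "\<dots> = 25 * ln (48/7)" by (subst ln_realpow) auto
    finally show ?thesis unfolding G_def s1 by simp
  qed
  ultimately obtain x where "3/5 \<le> x" "x \<le> 24/25" "G x = 0"
    using IVT'[of G "3/5" 0 "24/25"] cont by auto
  thus ?thesis by (auto simp: G_def)
qed

text \<open>All conditions are imposed on the whole line, so that derivatives at 0 and 1 are
  two-sided. The last one concerns the intercept of the tangent: differentiating the equation shows
  that \<phi>'' has the sign of this intercept. The bound c <= 1/2 leaves a nonnegative mass 1/2 - c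
  for the event that both coordinates are \<infinity>.\<close>

locale profile =
  fixes c \<kappa> :: real and \<phi> :: "real \<Rightarrow> real"
  assumes c_pos: "0 < c" and c_le: "c \<le> 1/2" and kappa_def: "\<kappa> = c/2 + c\<^sup>2"
    and phi_0: "\<phi> 0 = 1/2" and phi_1: "\<phi> 1 = c" and phi_pos: "\<And>r. 0 < \<phi> r"
    and phi_deriv: "\<And>r. (\<phi> has_real_derivative (\<kappa> * r / \<phi> r - 1) / 2) (at r)"
    and phi_intercept: "\<And>r. 0 < \<phi> r - r * ((\<kappa> * r / \<phi> r - 1) / 2)"

text \<open>The differential equation is homogeneous and integrates explicitly: with \<open>p + q = 1\<close>, \<open>q - p = \<delta>\<close>
  its solution is the curve \<open>r = \<delta> (e\<^sup>p\<^sup>t - e\<^sup>-\<^sup>q\<^sup>t)\<close>, \<open>\<phi> = (p e\<^sup>p\<^sup>t + q e\<^sup>-\<^sup>q\<^sup>t) / 2\<close>. The condition \<open>\<kappa> = c/2 + c\<^sup>2\<close>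
  at \<open>r = 1\<close> then amounts to \<open>coth (t/2) = sqrt (2 - \<delta>\<^sup>2)\<close> together with the equation for \<open>\<delta>\<close>
  solved above.\<close>

lemma profile_exists: "\<exists>c \<kappa> \<phi>. profile c \<kappa> \<phi>"
proof -
  from root_equation obtain \<delta> :: real where d: "3/5 \<le> \<delta>" "\<delta> \<le> 24/25"
    and root: "\<delta> * ln ((sqrt (2 - \<delta>\<^sup>2) + 1) / sqrt (1 - \<delta>\<^sup>2)) = ln (2 * \<delta> / sqrt (1 - \<delta>\<^sup>2))"
    by blast
  define T where "T = sqrt (2 - \<delta>\<^sup>2)"
  define R where "R = sqrt (1 - \<delta>\<^sup>2)"
  define p where "p = (1 - \<delta>) / 2"
  define q where "q = (1 + \<delta>) / 2"
  define c where "c = (T - \<delta>) / (4 * \<delta>)"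
  define \<kappa> where "\<kappa> = p * q / (2 * \<delta>\<^sup>2)"
  \<comment> \<open>The parameter at which the curve reaches r = 1. Since (T + 1)(T - 1) = R^2, it
    satisfies sinh(\<theta>/2) = 1/R, and the root equation becomes exp(\<delta>\<theta>/2) =
    2\<delta> sinh(\<theta>/2), which says r(\<theta>) = 1.\<close>
  define \<theta> where "\<theta> = 2 * ln ((T + 1) / R)"
  define r where "r = (\<lambda>t. \<delta> * (exp (p * t) - exp (- q * t)))"
  define h where "h = (\<lambda>t. (p * exp (p * t) + q * exp (- q * t)) / 2)"
  have d2: "\<delta>\<^sup>2 \<le> (24/25)\<^sup>2" using d by (intro power_mono) auto
  have d2': "\<delta>\<^sup>2 < 1" by (rule le_less_trans[OF d2]) (simp add: power2_eq_square)
  have T2: "T\<^sup>2 = 2 - \<delta>\<^sup>2" and T1: "1 < T" using d2' by (auto simp: T_def)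
  have R2: "R\<^sup>2 = 1 - \<delta>\<^sup>2" and R0: "0 < R" using d2' by (auto simp: R_def)
  have pq: "0 < p" "0 < q" "p + q = 1" "q - p = \<delta>" using d by (auto simp: p_def q_def field_simps)
  have hpos: "0 < h t" for t using pq by (auto simp: h_def intro!: add_pos_pos mult_pos_pos)
  have rder: "(r has_real_derivative 2 * \<delta> * h t) (at t)" for t
    unfolding r_def h_def by (auto intro!: derivative_eq_intros simp: algebra_simps)
  have hder: "(h has_real_derivative (p\<^sup>2 * exp (p * t) - q\<^sup>2 * exp (- q * t)) / 2) (at t)" for t
    unfolding h_def by (auto intro!: derivative_eq_intros simp: field_simps power2_eq_square)
  have mono: "r x < r y" if "x < y" for x y
    using that rder hpos d by (intro DERIV_pos_imp_increasing[of x y r]) (auto intro!: exI mult_pos_pos)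
  have contr: "continuous_on A r" for A
    using rder by (intro DERIV_continuous_on) (auto intro: has_field_derivative_at_within)
  \<comment> \<open>The exponential inequality gives r t >= \<delta> p t for t >= 0 and r t <=
    \<delta> q t for t <= 0. The witnesses invert these linear bounds.\<close>
  have surj: "\<exists>t. r t = y" for y
  proof (cases "0 \<le> y")
    case True
    let ?t = "y / (\<delta> * p)"
    have t0: "0 \<le> ?t" using True pq d by auto
    have "1 + p * ?t \<le> exp (p * ?t)" by (rule exp_ge_add_one_self)
    moreover have "exp (- q * ?t) \<le> 1" using t0 pq d True by simp
    ultimately have "p * ?t \<le> exp (p * ?t) - exp (- q * ?t)" by linarith
    hence "\<delta> * (p * ?t) \<le> r ?t" unfolding r_def using d by (intro mult_left_mono) auto
    hence "y \<le> r ?t" using pq d by simp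
    moreover have "r 0 = 0" by (simp add: r_def)
    ultimately show ?thesis using IVT'[of r 0 y ?t] contr True t0 by auto
  next
    case False
    let ?t = "y / (\<delta> * q)"
    have t0: "?t \<le> 0" using False pq d by (auto simp: divide_nonpos_pos)
    have "1 + - q * ?t \<le> exp (- q * ?t)" by (rule exp_ge_add_one_self)
    moreover have "exp (p * ?t) \<le> 1" using t0 pq by (simp add: mult_nonneg_nonpos del: times_divide_eq_right)
    ultimately have "exp (p * ?t) - exp (- q * ?t) \<le> q * ?t" by linarith
    hence "r ?t \<le> \<delta> * (q * ?t)" unfolding r_def using d by (intro mult_left_mono) auto
    hence "r ?t \<le> y" using pq d by simp
    moreover have "r 0 = 0" by (simp add: r_def)
    ultimately show ?thesis using IVT'[of r ?t y 0] contr False t0 by auto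
  qed
  have inj: "inj r" by (rule injI) (metis mono linorder_neq_iff less_irrefl)
  define g where "g = inv r"
  have gr: "g (r t) = t" for t unfolding g_def using inj by simp
  have rg: "r (g y) = y" for y unfolding g_def using surj by (metis f_inv_into_f rangeI)
  have gder: "(g has_real_derivative inverse (2 * \<delta> * h (g y))) (at y)" for y
  proof (rule has_field_derivative_inverse_basic[where f = r and t = UNIV])
    show "(r has_real_derivative 2 * \<delta> * h (g y)) (at (g y))" by (rule rder)
    have "isCont g (r (g y))"
      by (rule isCont_inverse_function[where d = 1 and f = r and x = "g y"])
         (rule zero_less_one gr DERIV_isCont[OF rder])+
    thus "continuous (at y) g" by (simp add: rg)
  qed (use hpos[of "g y"] d rg in auto)
  define \<phi> where "\<phi> = (\<lambda>y. h (g y))"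
  have deriv_eq: "(p\<^sup>2 * exp (p * t) - q\<^sup>2 * exp (- q * t)) / 2 * inverse (2 * \<delta> * h t)
      = (\<kappa> * r t / h t - 1) / 2" for t
  proof -
    have "(p\<^sup>2 * exp (p * t) - q\<^sup>2 * exp (- q * t)) / (2 * \<delta>) = \<kappa> * r t - h t"
    proof -
      define x where "x = exp (p * t)"
      define y where "y = exp (- q * t)"
      have "\<kappa> * r t = p * q * (x - y) / (2 * \<delta>)"
        using d by (simp add: \<kappa>_def r_def x_def y_def power2_eq_square)
      moreover have "h t = (q - p) * (p * x + q * y) / (2 * \<delta>)"
        using d pq(4) by (simp add: h_def x_def y_def)
      ultimately have "\<kappa> * r t - h t = (p * q * (x - y) - (q - p) * (p * x + q * y)) / (2 * \<delta>)"
        by (simp only: diff_divide_distrib)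
      also have "p * q * (x - y) - (q - p) * (p * x + q * y) = p\<^sup>2 * x - q\<^sup>2 * y"
        by (simp add: algebra_simps power2_eq_square)
      finally show ?thesis by (simp add: x_def y_def)
    qed
    hence "(p\<^sup>2 * exp (p * t) - q\<^sup>2 * exp (- q * t)) / (2 * \<delta>) / (2 * h t) = (\<kappa> * r t - h t) / (2 * h t)"
      by simp
    also have "\<dots> = (\<kappa> * r t / h t - 1) / 2" using hpos[of t] by (simp add: diff_divide_distrib)
    finally have "(p\<^sup>2 * exp (p * t) - q\<^sup>2 * exp (- q * t)) / (2 * \<delta>) / (2 * h t) = (\<kappa> * r t / h t - 1) / 2" .
    moreover have "A / 2 * inverse (2 * \<delta> * h t) = A / (2 * \<delta>) / (2 * h t)" for A
      by (simp add: inverse_eq_divide mult_ac)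
    ultimately show ?thesis by presburger
  qed
  have phider: "(\<phi> has_real_derivative (\<kappa> * y / \<phi> y - 1) / 2) (at y)" for y
  proof -
    have "((\<lambda>y. h (g y)) has_real_derivative (\<kappa> * r (g y) / h (g y) - 1) / 2) (at y)"
      unfolding deriv_eq[symmetric] by (rule DERIV_chain2[where f = h and g = g, OF hder gder])
    thus ?thesis by (simp add: \<phi>_def rg)
  qed
  \<comment> \<open>Multiplied by r', the intercept is the Wronskian of r and h. Both are
    combinations of the same two exponentials, so it is a constant multiple of their product x y and
    cannot change sign.\<close>
  have intercept: "0 < h t - r t * ((\<kappa> * r t / h t - 1) / 2)" for t
  proof -
    define x where "x = exp (p * t)"
    define y where "y = exp (- q * t)"
    have h: "h t = (p * x + q * y) / 2" and r: "r t = \<delta> * (x - y)"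
      by (simp_all add: h_def r_def x_def y_def)
    have "(p * x + q * y)\<^sup>2 - (x - y) * (p\<^sup>2 * x - q\<^sup>2 * y) = (p + q)\<^sup>2 * (x * y)"
      by (simp add: algebra_simps power2_eq_square)
    also have "\<dots> > 0" using pq by (simp add: x_def y_def)
    finally have "0 < (p * x + q * y)\<^sup>2 - (x - y) * (p\<^sup>2 * x - q\<^sup>2 * y)" .
    hence "(x - y) * (p\<^sup>2 * x - q\<^sup>2 * y) < 4 * (h t * h t)"
      by (simp add: h power2_eq_square)
    hence "(x - y) * (p\<^sup>2 * x - q\<^sup>2 * y) / (4 * h t) < h t"
      using hpos[of t] by (simp add: pos_divide_less_eq mult_ac)
    moreover have "r t * ((\<kappa> * r t / h t - 1) / 2) = (x - y) * (p\<^sup>2 * x - q\<^sup>2 * y) / (4 * h t)"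
    proof -
      have "\<delta> * (x - y) * (A / 2 * inverse (2 * \<delta> * h t)) = (x - y) * A / (4 * h t)" for A
        using d by (simp add: inverse_eq_divide mult_ac)
      thus ?thesis unfolding deriv_eq[symmetric] x_def[symmetric] y_def[symmetric] unfolding r .
    qed
    ultimately show ?thesis by linarith
  qed
  have g0: "g 0 = 0" using gr[of 0] by (simp add: r_def)
  have m0: "0 < (T + 1) / R" using T1 R0 by simp
  have expd: "exp (\<delta> * \<theta> / 2) = 2 * \<delta> / R"
    unfolding \<theta>_def using root d R0 by (simp add: T_def[symmetric] R_def[symmetric])
  have TR: "(T + 1) * (T - 1) = R * R"
    using T2 R2 by (simp add: algebra_simps power2_eq_square)
  have e1: "exp (p * \<theta>) = (T + 1) / (2 * \<delta>)"
  proof -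
    have "exp (p * \<theta>) = exp (\<theta> / 2) / exp (\<delta> * \<theta> / 2)"
      by (simp add: p_def exp_diff[symmetric] algebra_simps diff_divide_distrib)
    also have "exp (\<theta> / 2) = (T + 1) / R" using m0 by (simp add: \<theta>_def)
    also have "(T + 1) / R / exp (\<delta> * \<theta> / 2) = (T + 1) / (2 * \<delta>)" unfolding expd using R0 by simp
    finally show ?thesis .
  qed
  have e2: "exp (- q * \<theta>) = (T - 1) / (2 * \<delta>)"
  proof -
    have "- q * \<theta> = - (\<theta> / 2 + \<delta> * \<theta> / 2)" by (simp add: q_def field_simps)
    hence "exp (- q * \<theta>) = inverse (exp (\<theta> / 2) * exp (\<delta> * \<theta> / 2))"
      by (simp only: exp_minus exp_add)
    also have "exp (\<theta> / 2) = (T + 1) / R" using m0 by (simp add: \<theta>_def)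
    also have "inverse ((T + 1) / R * exp (\<delta> * \<theta> / 2)) = (R * R) / ((T + 1) * (2 * \<delta>))"
      unfolding expd by simp
    finally have "exp (- q * \<theta>) = (R * R) / ((T + 1) * (2 * \<delta>))" .
    thus ?thesis using T1 d by (simp add: TR[symmetric])
  qed
  have "r \<theta> = 1" unfolding r_def e1 e2 using d by (simp add: field_simps)
  hence g1: "g 1 = \<theta>" using gr[of \<theta>] by simp
  have "profile c \<kappa> \<phi>"
  proof
    show "0 < c" using T1 d by (simp add: c_def)
    \<comment> \<open>Equivalent to c <= 1/2. It amounts to \<delta>^2 >= 1/5, which the lower
      endpoint 3/5 of the root interval ensures.\<close>
    have "T \<le> 3 * \<delta>"
    proof (rule power2_le_imp_le)
      have "(3/5)\<^sup>2 \<le> \<delta>\<^sup>2" using d by (intro power_mono) auto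
      thus "T\<^sup>2 \<le> (3 * \<delta>)\<^sup>2" unfolding T2 power_mult_distrib by (simp add: power2_eq_square)
    qed (use d in auto)
    thus "c \<le> 1/2" using d by (simp add: c_def field_simps)
    have "c/2 + c\<^sup>2 = (T\<^sup>2 - \<delta>\<^sup>2) / (16 * \<delta>\<^sup>2)"
      using d by (simp add: c_def field_simps power2_eq_square)
    also have "\<dots> = \<kappa>" unfolding T2 \<kappa>_def p_def q_def using d by (simp add: field_simps power2_eq_square)
    finally show "\<kappa> = c/2 + c\<^sup>2" ..
    show "\<phi> 0 = 1/2" using pq by (simp add: \<phi>_def g0 h_def)
    have "\<phi> 1 = (p * ((T + 1) / (2 * \<delta>)) + q * ((T - 1) / (2 * \<delta>))) / 2"
      unfolding \<phi>_def g1 h_def e1 e2 ..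
    also have "\<dots> = c" unfolding p_def q_def c_def using d by (simp add: field_simps)
    finally show "\<phi> 1 = c" .
    show "0 < \<phi> y" for y using hpos by (simp add: \<phi>_def)
    show "(\<phi> has_real_derivative (\<kappa> * y / \<phi> y - 1) / 2) (at y)" for y by (rule phider)
    show "0 < \<phi> y - y * ((\<kappa> * y / \<phi> y - 1) / 2)" for y
      using intercept[of "g y"] by (simp add: \<phi>_def rg)
  qed
  thus ?thesis by blast
qed

subsection \<open>The density of the coupling\<close>

context profile
begin

definition d\<phi> :: "real \<Rightarrow> real" where "d\<phi> r = (\<kappa> * r / \<phi> r - 1) / 2"

definition d2\<phi> :: "real \<Rightarrow> real" where "d2\<phi> r = \<kappa> * (\<phi> r - r * d\<phi> r) / (2 * (\<phi> r)\<^sup>2)"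

lemma kappa_pos: "0 < \<kappa>"
  using c_pos by (simp add: kappa_def add_pos_pos)

lemma has_deriv_phi: "(\<phi> has_real_derivative d\<phi> r) (at r)"
  using phi_deriv by (simp add: d\<phi>_def)

lemma has_deriv_dphi: "(d\<phi> has_real_derivative d2\<phi> r) (at r)"
proof -
  have "((\<lambda>r. (\<kappa> * r / \<phi> r - 1) / 2) has_real_derivative d2\<phi> r) (at r)"
    using phi_pos[of r]
    by (auto intro!: derivative_eq_intros has_deriv_phi simp: d2\<phi>_def power2_eq_square field_simps)
  thus ?thesis by (simp add: d\<phi>_def[abs_def])
qed

lemma d2phi_pos: "0 < d2\<phi> r"
  using kappa_pos phi_intercept[of r] phi_pos[of r]
  by (auto simp: d2\<phi>_def d\<phi>_def intro!: divide_pos_pos mult_pos_pos)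

lemma dphi_mono: "x \<le> y \<Longrightarrow> d\<phi> x \<le> d\<phi> y"
  using has_deriv_dphi d2phi_pos by (intro DERIV_nonneg_imp_nondecreasing[of x y d\<phi>]) (auto intro: less_imp_le)

lemma dphi_0: "d\<phi> 0 = -1/2"
  by (simp add: d\<phi>_def)

text \<open>This slope expresses the absence of mass on the diagonal. Per unit of x the density puts
  mass -\<phi>'(1) = 1/4 - c/2 below the diagonal, and twice this is 1/2 - c, the rate at which P(X
  <= a, Y <= a) = a (1/2 - c) must grow.\<close>

lemma dphi_1: "d\<phi> 1 = c/2 - 1/4"
proof -
  have "\<kappa> / c = 1/2 + c" using c_pos by (simp add: kappa_def field_simps power2_eq_square)
  thus ?thesis by (simp add: d\<phi>_def phi_1)
qed

lemma phi_borel [measurable]: "\<phi> \<in> borel_measurable borel"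
  using has_deriv_phi DERIV_continuous_on[of UNIV \<phi> d\<phi>] by (intro borel_measurable_continuous_onI) auto

lemma dphi_borel [measurable]: "d\<phi> \<in> borel_measurable borel"
  unfolding d\<phi>_def[abs_def] by measurable

lemma d2phi_borel [measurable]: "d2\<phi> \<in> borel_measurable borel"
  unfolding d2\<phi>_def[abs_def] by measurable

text \<open>On \<open>0 < x < y\<close> this is \<open>- \<partial>\<^sub>x \<partial>\<^sub>y\<close> of \<open>y \<phi>(x/y)\<close>. All points above \<open>1\<close> represent \<open>\<infinity>\<close>, so that
  it only matters that the square \<open>(1, 2] \<times> (1, 2]\<close> carries the remaining mass \<open>1/2 - c\<close>.\<close>

definition dens :: "real \<Rightarrow> real \<Rightarrow> real" where
  "dens x y =
     (if 0 < x \<and> 0 < y \<and> (x \<le> 1 \<or> y \<le> 1) then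
        min x y / max x y * d2\<phi> (min x y / max x y) / max x y
      else if 1 < x \<and> x \<le> 2 \<and> 1 < y \<and> y \<le> 2 then 1/2 - c else 0)"

lemma dens_commute: "dens x y = dens y x"
  by (auto simp: dens_def min.commute max.commute)

lemma dens_borel [measurable]:
  assumes [measurable]: "f \<in> borel_measurable M" "g \<in> borel_measurable M"
  shows "(\<lambda>z. dens (f z) (g z)) \<in> borel_measurable M"
  unfolding dens_def by measurable

lemma dens_nonpos: "x \<le> 0 \<Longrightarrow> dens x y = 0"
  by (auto simp: dens_def)

text \<open>Integration by parts: r \<phi>''(r) has the antiderivative r \<phi>'(r) - \<phi>(r). The
  result equals -\<phi>'(1), which later cancels the boundary term of the part above the
  diagonal.\<close>

lemma inner_below:
  assumes x: "0 < x" "x \<le> 1"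
  shows "(\<integral>\<^sup>+y. ennreal (y / x * d2\<phi> (y / x) / x) * indicator {0..x} y \<partial>lborel) = ennreal (1/4 - c/2)"
proof -
  have "(\<integral>\<^sup>+y. ennreal (y / x * d2\<phi> (y / x) / x) * indicator {0..x} y \<partial>lborel)
      = ennreal ((x / x * d\<phi> (x / x) - \<phi> (x / x)) - (0 / x * d\<phi> (0 / x) - \<phi> (0 / x)))"
  proof (rule nn_integral_FTC_Icc)
    fix y assume "y \<in> {0..x}"
    show "((\<lambda>y. y / x * d\<phi> (y / x) - \<phi> (y / x)) has_real_derivative y / x * d2\<phi> (y / x) / x) (at y)"
      using x by (auto intro!: derivative_eq_intros DERIV_chain2[OF has_deriv_phi] DERIV_chain2[OF has_deriv_dphi] simp: field_simps)
    show "0 \<le> y / x * d2\<phi> (y / x) / x" using \<open>y \<in> {0..x}\<close> d2phi_pos[of "y / x"] x by simp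
  qed (use x in auto)
  thus ?thesis using x by (simp add: phi_0 phi_1 dphi_1)
qed

lemma above_deriv:
  assumes "0 < x" "0 < y"
  shows "((\<lambda>y. - d\<phi> (x / y)) has_real_derivative x / y * d2\<phi> (x / y) / y) (at y)"
  using assms by (auto intro!: derivative_eq_intros DERIV_chain2[OF has_deriv_dphi] simp: field_simps power2_eq_square)

text \<open>The disjunction lets one split serve both the distribution function and the marginal.
  The two pieces overlap at y = x, so the integrands agree only almost everywhere.\<close>

lemma dens_split:
  assumes x: "0 < x" "x \<le> 1" and B: "B = {..b} \<and> x \<le> b \<and> C = {x..b} \<or> B = UNIV \<and> C = {x..}"
  shows "(\<integral>\<^sup>+y. ennreal (dens x y) * indicator B y \<partial>lborel) =
    ennreal (1/4 - c/2) + (\<integral>\<^sup>+y. ennreal (x / y * d2\<phi> (x / y) / y) * indicator C y \<partial>lborel)"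
proof -
  have [measurable]: "C \<in> sets borel" using B by auto
  have "(\<integral>\<^sup>+y. ennreal (dens x y) * indicator B y \<partial>lborel) =
    (\<integral>\<^sup>+y. ennreal (y / x * d2\<phi> (y / x) / x) * indicator {0..x} y
        + ennreal (x / y * d2\<phi> (x / y) / y) * indicator C y \<partial>lborel)"
  proof (rule nn_integral_cong_AE)
    have "AE y in lborel. y \<noteq> 0 \<and> y \<noteq> x"
      using AE_lborel_singleton[of 0] AE_lborel_singleton[of x] by eventually_elim auto
    thus "AE y in lborel. ennreal (dens x y) * indicator B y =
      ennreal (y / x * d2\<phi> (y / x) / x) * indicator {0..x} y
        + ennreal (x / y * d2\<phi> (x / y) / y) * indicator C y"
      by eventually_elim (use x B in \<open>auto simp: dens_def indicator_def min_def max_def\<close>)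
  qed
  also have "\<dots> = (\<integral>\<^sup>+y. ennreal (y / x * d2\<phi> (y / x) / x) * indicator {0..x} y \<partial>lborel)
     + (\<integral>\<^sup>+y. ennreal (x / y * d2\<phi> (x / y) / y) * indicator C y \<partial>lborel)"
    by (rule nn_integral_add) auto
  finally show ?thesis unfolding inner_below[OF x] .
qed

lemma inner_Iic:
  assumes x: "0 < x" "x \<le> 1" "x \<le> b"
  shows "(\<integral>\<^sup>+y. ennreal (dens x y) * indicator {..b} y \<partial>lborel) = ennreal (- d\<phi> (x / b))"
proof -
  have "(\<integral>\<^sup>+y. ennreal (x / y * d2\<phi> (x / y) / y) * indicator {x..b} y \<partial>lborel)
     = ennreal (- d\<phi> (x / b) - - d\<phi> (x / x))"
  proof (rule nn_integral_FTC_Icc)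
    fix y assume "y \<in> {x..b}"
    thus "((\<lambda>y. - d\<phi> (x / y)) has_real_derivative x / y * d2\<phi> (x / y) / y) (at y)"
      using x by (intro above_deriv) auto
    show "0 \<le> x / y * d2\<phi> (x / y) / y" using \<open>y \<in> {x..b}\<close> d2phi_pos[of "x / y"] x by simp
  qed (use x in auto)
  moreover have "d\<phi> (x / b) \<le> d\<phi> (x / x)" using x by (intro dphi_mono) auto
  ultimately show ?thesis
    using x c_le by (subst dens_split[where C = "{x..b}" and b = b])
      (auto simp: dphi_1 ennreal_plus[symmetric] simp del: ennreal_plus)
qed

text \<open>The constant is -\<phi>'(0), the limit of the antiderivative as y tends to infinity. It
  does not depend on x, so the first marginal is half of the uniform law on the unit
  interval.\<close>

lemma inner_UNIV:
  assumes x: "0 < x" "x \<le> 1"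
  shows "(\<integral>\<^sup>+y. ennreal (dens x y) * indicator UNIV y \<partial>lborel) = ennreal (1/2)"
proof -
  have "(\<integral>\<^sup>+y. ennreal (x / y * d2\<phi> (x / y) / y) * indicator {x..} y \<partial>lborel)
     = ennreal (1/2 - - d\<phi> (x / x))"
  proof (rule nn_integral_FTC_atLeast[where F = "\<lambda>y. - d\<phi> (x / y)"])
    fix y assume "x \<le> y"
    thus "((\<lambda>y. - d\<phi> (x / y)) has_real_derivative x / y * d2\<phi> (x / y) / y) (at y)"
      using x by (intro above_deriv) auto
    show "0 \<le> x / y * d2\<phi> (x / y) / y" using \<open>x \<le> y\<close> d2phi_pos[of "x / y"] x by simp
  next
    have "((\<lambda>y. x / y) \<longlongrightarrow> 0) at_top" by real_asymp
    hence "((\<lambda>y. - d\<phi> (x / y)) \<longlongrightarrow> - d\<phi> 0) at_top"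
      by (intro tendsto_minus isCont_tendsto_compose[OF DERIV_isCont[OF has_deriv_dphi]])
    thus "((\<lambda>y. - d\<phi> (x / y)) \<longlongrightarrow> 1/2) at_top" by (simp add: dphi_0)
  qed (use x in auto)
  thus ?thesis
    using x c_le c_pos dens_split[of x UNIV 0 "{x..}"]
      by (simp add: dphi_1 ennreal_plus[symmetric] del: ennreal_plus)
qed

section \<open>The planar law with this density: symmetry, distribution function and total
  mass\<close>

definition joint :: "(real \<times> real) measure" where
  "joint = density (lborel \<Otimes>\<^sub>M lborel) (\<lambda>z. ennreal (dens (fst z) (snd z)))"

lemma sets_joint [measurable_cong, simp]: "sets joint = sets (borel \<Otimes>\<^sub>M borel)"
  by (simp add: joint_def cong: sets_pair_measure_cong)

lemma space_joint [simp]: "space joint = UNIV"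
  by (simp add: joint_def space_pair_measure)

lemma emeasure_joint:
  assumes [measurable]: "A \<in> sets borel" "B \<in> sets borel"
  shows "emeasure joint (A \<times> B) =
    (\<integral>\<^sup>+x. (\<integral>\<^sup>+y. ennreal (dens x y) * indicator B y \<partial>lborel) * indicator A x \<partial>lborel)"
proof -
  have "emeasure joint (A \<times> B) =
    (\<integral>\<^sup>+z. ennreal (dens (fst z) (snd z)) * indicator (A \<times> B) z \<partial>(lborel \<Otimes>\<^sub>M lborel))"
    unfolding joint_def by (rule emeasure_density) measurable
  also have "\<dots> = (\<integral>\<^sup>+x. \<integral>\<^sup>+y. ennreal (dens x y) * indicator (A \<times> B) (x, y) \<partial>lborel \<partial>lborel)"
    by (subst lborel.nn_integral_fst[symmetric]) simp_all
  also have "\<dots> = (\<integral>\<^sup>+x. (\<integral>\<^sup>+y. ennreal (dens x y) * indicator B y \<partial>lborel) * indicator A x \<partial>lborel)"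
    by (intro nn_integral_cong) (auto simp: indicator_def)
  finally show ?thesis .
qed

lemma emeasure_joint_commute:
  assumes [measurable]: "A \<in> sets borel" "B \<in> sets borel"
  shows "emeasure joint (A \<times> B) = emeasure joint (B \<times> A)"
proof -
  have "emeasure joint (A \<times> B) =
    (\<integral>\<^sup>+x. \<integral>\<^sup>+y. ennreal (dens x y) * indicator B y * indicator A x \<partial>lborel \<partial>lborel)"
    by (simp add: emeasure_joint nn_integral_multc)
  also have "\<dots> = (\<integral>\<^sup>+y. \<integral>\<^sup>+x. ennreal (dens x y) * indicator B y * indicator A x \<partial>lborel \<partial>lborel)"
    by (rule lborel_pair.Fubini'[symmetric]) measurable
  also have "\<dots> = (\<integral>\<^sup>+x. \<integral>\<^sup>+y. ennreal (dens x y) * indicator A y * indicator B x \<partial>lborel \<partial>lborel)"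
    by (intro nn_integral_cong) (simp add: dens_commute mult_ac)
  also have "\<dots> = emeasure joint (B \<times> A)"
    by (simp add: emeasure_joint nn_integral_multc)
  finally show ?thesis .
qed

lemma emeasure_joint_Iic:
  assumes "0 \<le> a" "a \<le> 1" "a \<le> b"
  shows "emeasure joint ({..a} \<times> {..b}) = ennreal (b / 2 - b * \<phi> (a / b))"
proof (cases "a = 0")
  \<comment> \<open>Here b may be 0 as well. Once a > 0, also b > 0 and x / b can be used as the
    argument of the profile.\<close>
  case True
  have "(\<integral>\<^sup>+y. ennreal (dens x y) * indicator {..b} y \<partial>lborel) * indicator {..a} x = 0" for x
    using True by (cases "x \<le> 0") (auto simp: dens_nonpos)
  hence "emeasure joint ({..a} \<times> {..b}) = 0"
    by (simp only: emeasure_joint[OF borel_closed[OF closed_atMost] borel_closed[OF closed_atMost]]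
        nn_integral_const mult_zero_left)
  thus ?thesis using True by (simp add: phi_0)
next
  case False
  hence a: "0 < a" "0 < b" using assms by auto
  have "emeasure joint ({..a} \<times> {..b}) = (\<integral>\<^sup>+x. ennreal (- d\<phi> (x / b)) * indicator {0..a} x \<partial>lborel)"
  proof (subst emeasure_joint, simp_all, rule nn_integral_cong_AE)
    have *: "(\<integral>\<^sup>+y. ennreal (dens x y) * indicator {..b} y \<partial>lborel) * indicator {..a} x
        = ennreal (- d\<phi> (x / b)) * indicator {0..a} x" if "x \<noteq> 0" for x
    proof (cases "x \<in> {0..a}")
      case True
      thus ?thesis using inner_Iic[of x b] assms that by simp
    next
      case False
      thus ?thesis using assms by (auto simp: dens_nonpos indicator_def)
    qed
    show "AE x in lborel. (\<integral>\<^sup>+y. ennreal (dens x y) * indicator {..b} y \<partial>lborel) * indicator {..a} x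
        = ennreal (- d\<phi> (x / b)) * indicator {0..a} x"
      using AE_lborel_singleton[of 0] by eventually_elim (rule *)
  qed
  also have "\<dots> = ennreal (- b * \<phi> (a / b) - - b * \<phi> (0 / b))"
  proof (rule nn_integral_FTC_Icc)
    fix x assume x: "x \<in> {0..a}"
    show "((\<lambda>x. - b * \<phi> (x / b)) has_real_derivative - d\<phi> (x / b)) (at x)"
      using a by (auto intro!: derivative_eq_intros DERIV_chain2[OF has_deriv_phi])
    have "d\<phi> (x / b) \<le> d\<phi> 1" using x a assms by (intro dphi_mono) auto
    thus "0 \<le> - d\<phi> (x / b)" using c_le by (simp add: dphi_1)
  qed (use a in auto)
  finally show ?thesis by (simp add: phi_0)
qed

lemma emeasure_joint_Iic_UNIV:
  assumes "0 \<le> a" "a \<le> 1"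
  shows "emeasure joint ({..a} \<times> UNIV) = ennreal (a / 2)"
proof -
  have "emeasure joint ({..a} \<times> UNIV) = (\<integral>\<^sup>+x. ennreal (1/2) * indicator {0..a} x \<partial>lborel)"
  proof (unfold emeasure_joint[OF borel_closed[OF closed_atMost] borel_closed[OF closed_UNIV]], rule nn_integral_cong_AE)
    have *: "(\<integral>\<^sup>+y. ennreal (dens x y) * indicator UNIV y \<partial>lborel) * indicator {..a} x
        = ennreal (1/2) * indicator {0..a} x" if "x \<noteq> 0" for x
    proof (cases "x \<in> {0..a}")
      case True
      hence "(\<integral>\<^sup>+y. ennreal (dens x y) * indicator UNIV y \<partial>lborel) = ennreal (1/2)"
        using assms that by (intro inner_UNIV) auto
      thus ?thesis using True by (simp del: indicator_UNIV)
    next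
      case False
      thus ?thesis using assms by (auto simp: dens_nonpos indicator_def)
    qed
    show "AE x in lborel. (\<integral>\<^sup>+y. ennreal (dens x y) * indicator UNIV y \<partial>lborel) * indicator {..a} x
        = ennreal (1/2) * indicator {0..a} x"
      using AE_lborel_singleton[of 0] by eventually_elim (rule *)
  qed
  also have "\<dots> = ennreal (1/2) * ennreal a"
    using assms by (subst nn_integral_cmult_indicator) auto
  also have "\<dots> = ennreal (1/2 * a)"
    using assms by (intro ennreal_mult[symmetric]) auto
  finally show ?thesis by simp
qed

lemma emeasure_joint_1: "emeasure joint ({1<..} \<times> {1<..}) = ennreal (1/2 - c)"
proof -
  have *: "(\<integral>\<^sup>+y. ennreal (dens x y) * indicator {1<..} y \<partial>lborel) * indicator {1<..} x
    = (\<integral>\<^sup>+y. ennreal (1/2 - c) * indicator {1<..2} y \<partial>(lborel :: real measure)) * indicator {1<..2} x" for x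
  proof (cases "1 < x")
    case True
    have "ennreal (dens x y) * indicator {1<..} y
      = ennreal (1/2 - c) * indicator {1<..2} y * indicator {1<..2} x" for y
      using True by (auto simp: dens_def indicator_def)
    thus ?thesis using True by (simp add: nn_integral_multc)
  qed simp
  have "emeasure joint ({1<..} \<times> {1<..}) =
      (\<integral>\<^sup>+x. (\<integral>\<^sup>+y. ennreal (1/2 - c) * indicator {1<..2} y \<partial>(lborel :: real measure)) * indicator {1<..2} x \<partial>(lborel :: real measure))"
    unfolding emeasure_joint[OF borel_open[OF open_greaterThan] borel_open[OF open_greaterThan]] * ..
  also have "\<dots> = ennreal (1/2 - c)"
    by (subst nn_integral_cmult_indicator, simp, subst nn_integral_cmult_indicator) auto
  finally show ?thesis .
qed

text \<open>The pieces 1/2, c and 1/2 - c belong to a finite first coordinate, to an infinite first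
  with a finite second, and to both infinite. The middle one is found by subtracting the square from
  the second marginal, which symmetry provides.\<close>

lemma prob_space_joint: "prob_space joint"
proof
  have e: "emeasure joint ({..1} \<times> UNIV) = ennreal (1/2)"
    by (rule emeasure_joint_Iic_UNIV) auto
  have e': "emeasure joint (UNIV \<times> {..1}) = ennreal (1/2)"
    by (subst emeasure_joint_commute) (simp_all add: e)
  have e2: "emeasure joint ({..1} \<times> {..1}) = ennreal (1/2 - c)"
    by (subst emeasure_joint_Iic) (simp_all add: phi_1)
  have "ennreal (1/2) = emeasure joint ({..1} \<times> {..1} \<union> {1<..} \<times> {..1})"
    unfolding e'[symmetric] by (intro arg_cong[where f = "emeasure joint"]) auto
  also have "\<dots> = ennreal (1/2 - c) + emeasure joint ({1<..} \<times> {..1})"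
    by (subst plus_emeasure[symmetric]) (auto simp: e2)
  finally have "emeasure joint ({1<..} \<times> {..1}) = ennreal (1/2) - ennreal (1/2 - c)"
    by (metis ennreal_add_diff_cancel_left ennreal_neq_top infinity_ennreal_def)
  also have "\<dots> = ennreal c" using c_le c_pos by (subst ennreal_minus) auto
  finally have e3: "emeasure joint ({1<..} \<times> {..1}) = ennreal c" .
  have "emeasure joint (space joint) = emeasure joint (({..1} \<times> UNIV) \<union> ({1<..} \<times> {..1} \<union> {1<..} \<times> {1<..}))"
    by (intro arg_cong[where f = "emeasure joint"]) auto
  also have "\<dots> = ennreal (1/2) + (ennreal c + ennreal (1/2 - c))"
    by (subst plus_emeasure[symmetric], simp, simp, force, subst plus_emeasure[symmetric])
      (auto simp: e e3 emeasure_joint_1)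
  also have "\<dots> = ennreal (1/2 + (c + (1/2 - c)))"
    using c_le c_pos by (simp only: ennreal_plus add_nonneg_nonneg diff_ge_0_iff_ge less_imp_le zero_le_divide_1_iff zero_le_numeral)
  also have "\<dots> = 1" by simp
  finally show "emeasure joint (space joint) = 1" .
qed

end

subsection \<open>Laws on pairs of points of \<open>I\<close>\<close>

lemma borel_ereal_Iic: "(borel :: ereal measure) = sigma UNIV (range atMost)"
  unfolding borel_Ioi
proof (intro sigma_eqI sigma_sets_eqI)
  fix A :: "ereal set" assume "A \<in> range greaterThan"
  then obtain a where "A = {a<..}" by auto
  hence A: "A = UNIV - {..a}" by auto
  show "A \<in> sigma_sets UNIV (range atMost)"
    unfolding A by (intro sigma_sets.Compl sigma_sets.Basic) auto
next
  fix A :: "ereal set" assume "A \<in> range atMost"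
  then obtain a where "A = {..a}" by auto
  hence A: "A = UNIV - {a<..}" by auto
  show "A \<in> sigma_sets UNIV (range greaterThan)"
    unfolding A by (intro sigma_sets.Compl sigma_sets.Basic) auto
qed auto

text \<open>The argument is extended real so that the family contains the whole space, as
  \<open>lower \<infinity>\<close>, and is still closed under intersection.\<close>

definition lower :: "ereal \<Rightarrow> ereal set" where "lower s = {x\<in>I_set. x \<le> s}"

lemma lower_sets [measurable]: "lower s \<in> sets I_space"
proof -
  have "lower s = I_set \<inter> {..s}" by (auto simp: lower_def)
  thus ?thesis by (auto simp: sets_I_space_iff I_borel)
qed

lemma lower_infinity: "lower \<infinity> = I_set"
  by (auto simp: lower_def)

lemma lower_cases: "lower a = {} \<or> (\<exists>s\<in>{0..1}. lower a = lower (ereal s)) \<or> lower a = lower \<infinity>"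
proof -
  consider "a < 0" | r where "a = ereal r" "0 \<le> r" "r \<le> 1" | "1 < a" "a \<noteq> \<infinity>" | "a = \<infinity>"
    by (cases a) (auto simp: not_less one_ereal_def, (force simp: not_le)?)
  thus ?thesis
  proof cases
    case 1
    hence "\<not> x \<le> a" if "x \<in> I_set" for x
      using that by (force simp: I_set_def)
    hence "lower a = {}" unfolding lower_def by blast
    thus ?thesis ..
  next
    case 2
    thus ?thesis by (intro disjI2 disjI1 bexI[of _ r]) simp_all
  next
    case 3
    have "x \<le> a \<longleftrightarrow> x \<le> ereal 1" if "x \<in> I_set" for x
      using that 3 by (auto simp: I_set_def one_ereal_def intro: order_trans less_imp_le)
    hence "lower a = lower (ereal 1)" unfolding lower_def by blast
    thus ?thesis by (intro disjI2 disjI1 bexI[of _ 1]) simp_all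
  qed simp
qed

lemma sets_I_space_lower: "sets I_space = sigma_sets I_set (range lower)"
proof -
  have "sets I_space = (\<inter>) I_set ` sigma_sets UNIV (range atMost)"
    unfolding I_space_def sets_restrict_space borel_ereal_Iic by simp
  also have "\<dots> = sigma_sets I_set ((\<inter>) I_set ` range atMost)"
    using I_borel unfolding borel_ereal_Iic by (intro sigma_sets_Int) auto
  also have "(\<inter>) I_set ` range atMost = range lower"
  proof -
    have "lower = (\<lambda>a. I_set \<inter> {..a})" by (auto simp: lower_def)
    thus ?thesis by (simp only: image_image)
  qed
  finally show ?thesis .
qed

text \<open>The rectangles form an intersection-stable generator. Those with a full side need
  hypotheses of their own: the atom at \<infinity> keeps them out of reach of finite s and
  t.\<close>

lemma measure_eqI_lower:
  assumes "prob_space M" "prob_space N"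
    and M: "sets M = sets (I_space \<Otimes>\<^sub>M I_space)" and N: "sets N = sets (I_space \<Otimes>\<^sub>M I_space)"
    and eq: "\<And>s t. s \<in> {0..1} \<Longrightarrow> t \<in> {0..1} \<Longrightarrow>
      emeasure M (lower (ereal s) \<times> lower (ereal t)) = emeasure N (lower (ereal s) \<times> lower (ereal t))"
    and eq1: "\<And>s. s \<in> {0..1} \<Longrightarrow>
      emeasure M (lower (ereal s) \<times> I_set) = emeasure N (lower (ereal s) \<times> I_set)"
    and eq2: "\<And>s. s \<in> {0..1} \<Longrightarrow>
      emeasure M (I_set \<times> lower (ereal s)) = emeasure N (I_set \<times> lower (ereal s))"
  shows "M = N"
proof -
  interpret M: prob_space M by fact
  interpret N: prob_space N by fact
  define E where "E = {a \<times> b | a b. a \<in> range lower \<and> b \<in> range lower}"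
  have sub: "range lower \<subseteq> Pow I_set" by (auto simp: lower_def)
  have E: "sets (I_space \<Otimes>\<^sub>M I_space) = sigma_sets (I_set \<times> I_set) E"
  proof -
    have "sets (I_space \<Otimes>\<^sub>M I_space) = sets (sigma (I_set \<times> I_set) E)"
      unfolding E_def using sub
      by (subst sets_pair_eq[where Ca = "{lower \<infinity>}" and Cb = "{lower \<infinity>}" and Ea = "range lower" and Eb = "range lower"])
        (simp_all add: space_I_space sets_I_space_lower lower_infinity rangeI[of lower \<infinity>, unfolded lower_infinity])
    also have "\<dots> = sigma_sets (I_set \<times> I_set) E"
      using sub by (intro sets_measure_of) (auto simp: E_def)
    finally show ?thesis .
  qed
  have sp: "space M = I_set \<times> I_set" "space N = I_set \<times> I_set"
    using sets_eq_imp_space_eq[OF M] sets_eq_imp_space_eq[OF N] by (simp_all add: space_pair_measure space_I_space)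
  show ?thesis
  proof (rule measure_eqI_generator_eq[where E = E and A = "\<lambda>_. I_set \<times> I_set"])
    have *: "lower a \<inter> lower b = lower (min a b)" for a b by (auto simp: lower_def)
    show "Int_stable E"
    proof (rule Int_stableI)
      fix A B assume "A \<in> E" "B \<in> E"
      then obtain a b a' b' where "A = lower a \<times> lower b" "B = lower a' \<times> lower b'" by (auto simp: E_def)
      hence "A \<inter> B = lower (min a a') \<times> lower (min b b')" by (auto simp: *[symmetric])
      thus "A \<inter> B \<in> E" by (auto simp: E_def)
    qed
    show "E \<subseteq> Pow (I_set \<times> I_set)" using sub by (auto simp: E_def)
    show "sets M = sigma_sets (I_set \<times> I_set) E" "sets N = sigma_sets (I_set \<times> I_set) E"
      using M N E by simp_all
    have "lower \<infinity> \<times> lower \<infinity> \<in> E" unfolding E_def by blast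
    thus "range (\<lambda>_. I_set \<times> I_set) \<subseteq> E" by (auto simp: lower_infinity)
    fix X assume "X \<in> E"
    then obtain a b where X: "X = lower a \<times> lower b" by (auto simp: E_def)
    have top: "emeasure M (I_set \<times> I_set) = emeasure N (I_set \<times> I_set)"
      using M.emeasure_space_1 N.emeasure_space_1 by (simp add: sp)
    show "emeasure M X = emeasure N X"
      using lower_cases[of a] lower_cases[of b] unfolding X lower_infinity
      by (elim disjE bexE) (simp_all add: eq eq1 eq2 top)
  qed auto
qed

lemma gamma_le_iff: "gamma t x y \<le> ereal s \<longleftrightarrow> ereal t < min x y \<and> min x y \<le> ereal s"
  by (auto simp: gamma_def)

lemma I_space_borel: "f \<in> M \<rightarrow>\<^sub>M I_space \<Longrightarrow> f \<in> borel_measurable M"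
  unfolding I_space_def by (simp add: measurable_restrict_space2_iff)

lemma unit_space_borel: "f \<in> M \<rightarrow>\<^sub>M unit_space \<Longrightarrow> f \<in> borel_measurable M"
  unfolding unit_space_def by (simp add: measurable_restrict_space2_iff)

lemma measurable_gamma [measurable]:
  assumes "t \<in> M \<rightarrow>\<^sub>M unit_space" "x \<in> M \<rightarrow>\<^sub>M I_space" "y \<in> M \<rightarrow>\<^sub>M I_space"
  shows "(\<lambda>\<omega>. gamma (t \<omega>) (x \<omega>) (y \<omega>)) \<in> M \<rightarrow>\<^sub>M I_space"
proof -
  note [measurable] = I_space_borel[OF assms(2)] I_space_borel[OF assms(3)] unit_space_borel[OF assms(1)]
  have "gamma (t \<omega>) (x \<omega>) (y \<omega>) \<in> I_set" if "\<omega> \<in> space M" for \<omega>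
    using measurable_space[OF assms(2) that] measurable_space[OF assms(3) that]
    by (auto simp: gamma_def space_I_space min_def I_set_def)
  moreover have "(\<lambda>\<omega>. gamma (t \<omega>) (x \<omega>) (y \<omega>)) \<in> borel_measurable M"
    unfolding gamma_def by measurable
  ultimately show ?thesis unfolding I_space_def by (intro measurable_restrict_space2) auto
qed

lemma sets_uniform01 [simp, measurable_cong]: "sets uniform01 = sets unit_space"
  by (simp add: uniform01_def unit_space_def sets_restrict_space)

lemma prob_space_uniform01: "prob_space uniform01"
  by (rule prob_spaceI) (simp add: uniform01_def space_restrict_space emeasure_restrict_space)

lemma nn_integral_uniform01: "(\<integral>\<^sup>+x. f x \<partial>uniform01) = (\<integral>\<^sup>+x. f x * indicator {0..1} x \<partial>lborel)"
  unfolding uniform01_def by (subst nn_integral_restrict_space) auto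

text \<open>Under \<open>s \<mapsto> 2 - 1/s\<close> the finite part of \<^term>\<open>nu\<close>, which lives on \<open>[1/2, 1]\<close>, becomes
  half of the uniform distribution on the unit interval. In the other direction, everything
  above \<open>1\<close> is sent to \<open>\<infinity>\<close>.\<close>

definition alpha :: "real \<Rightarrow> real" where "alpha s = (if s \<le> 1/2 then 0 else 2 - 1/s)"

lemma alpha_bounds: "s \<le> 1 \<Longrightarrow> 0 \<le> alpha s \<and> alpha s \<le> 1"
  by (auto simp: alpha_def field_simps)

lemma alpha_mono: "s \<le> t \<Longrightarrow> alpha s \<le> alpha t"
  by (auto simp: alpha_def field_simps)

definition unalpha :: "real \<Rightarrow> ereal" where
  "unalpha a = (if a \<le> 0 then 0 else if a \<le> 1 then ereal (1 / (2 - a)) else \<infinity>)"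

text \<open>\<open>unalpha\<close> is a generalised inverse of \<open>alpha\<close>, which turns
  lower sets into half lines. Sending all a <= 0 to 0 makes this hold down to s = 0; the density
  vanishes on that half line.\<close>

lemma unalpha_le_iff:
  assumes "0 \<le> s" "s \<le> 1"
  shows "unalpha a \<le> ereal s \<longleftrightarrow> a \<le> alpha s"
proof (cases "a \<le> 0 \<or> 1 < a")
  case True
  thus ?thesis using alpha_bounds[of s] assms by (auto simp: unalpha_def)
next
  case False
  hence "unalpha a \<le> ereal s \<longleftrightarrow> 1 \<le> s * (2 - a)" by (simp add: unalpha_def field_simps)
  also have "\<dots> \<longleftrightarrow> a \<le> alpha s"
  proof (cases "s \<le> 1/2")
    case True
    have "s * (2 - a) \<le> 1/2 * (2 - a)" using False True by (intro mult_right_mono) auto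
    also have "\<dots> < 1" using False by simp
    finally show ?thesis using True False by (simp add: alpha_def)
  next
    case False
    thus ?thesis by (simp add: alpha_def field_simps)
  qed
  finally show ?thesis .
qed

lemma unalpha_measurable [measurable]: "unalpha \<in> borel \<rightarrow>\<^sub>M I_space"
  unfolding I_space_def
proof (rule measurable_restrict_space2)
  show "unalpha \<in> space borel \<rightarrow> I_set"
    by (auto simp: unalpha_def I_set_def)
  show "unalpha \<in> borel_measurable borel" unfolding unalpha_def[abs_def] by measurable
qed

lemma unalpha_in_I_set: "unalpha a \<in> I_set"
  by (auto simp: unalpha_def I_set_def)

lemma vimage_unalpha_lower: "0 \<le> s \<Longrightarrow> s \<le> 1 \<Longrightarrow> unalpha -` lower (ereal s) = {..alpha s}"
  by (auto simp: lower_def unalpha_in_I_set unalpha_le_iff)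

text \<open>\<open>alpha\<close> vanishes on [0, 1/2], so the integrands over the value r of \<tau>
  are constant there and smooth only afterwards. The term \<open>f 0 / 2\<close> is the contribution
  of the constant stretch.\<close>

lemma nn_integral_two_pieces:
  fixes f F :: "real \<Rightarrow> real"
  assumes s: "1/2 \<le> s" and [measurable]: "f \<in> borel_measurable borel"
    and nonneg: "\<And>r. 0 \<le> r \<Longrightarrow> r \<le> s \<Longrightarrow> 0 \<le> f r"
    and const: "\<And>r. 0 \<le> r \<Longrightarrow> r \<le> 1/2 \<Longrightarrow> f r = f 0"
    and deriv: "\<And>r. 1/2 \<le> r \<Longrightarrow> r \<le> s \<Longrightarrow> (F has_real_derivative f r) (at r)"
  shows "(\<integral>\<^sup>+r. ennreal (f r) * indicator {0..s} r \<partial>lborel) = ennreal (f 0 / 2 + (F s - F (1/2)))"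
proof -
  have "(\<integral>\<^sup>+r. ennreal (f r) * indicator {0..s} r \<partial>lborel) =
    (\<integral>\<^sup>+r. ennreal (f 0) * indicator {0..1/2} r + ennreal (f r) * indicator {1/2..s} r \<partial>lborel)"
  proof (rule nn_integral_cong_AE)
    have "ennreal (f r) * indicator {0..s} r =
      ennreal (f 0) * indicator {0..1/2} r + ennreal (f r) * indicator {1/2..s} r" if "r \<noteq> 1/2" for r
      using s that const[of r] by (cases "r < 1/2") (simp_all add: indicator_def)
    thus "AE r in lborel. ennreal (f r) * indicator {0..s} r =
      ennreal (f 0) * indicator {0..1/2} r + ennreal (f r) * indicator {1/2..s} r"
      using AE_lborel_singleton[of "1/2"] by (auto elim!: eventually_mono)
  qed
  also have "\<dots> = ennreal (f 0) * emeasure lborel {0..1/2::real}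
     + (\<integral>\<^sup>+r. ennreal (f r) * indicator {1/2..s} r \<partial>lborel)"
    by (subst nn_integral_add) (auto simp: nn_integral_cmult_indicator)
  also have "ennreal (f 0) * emeasure lborel {0..1/2::real} = ennreal (f 0 * (1/2))"
    using nonneg[of 0] s by (subst ennreal_mult) auto
  also have "(\<integral>\<^sup>+r. ennreal (f r) * indicator {1/2..s} r \<partial>lborel) = ennreal (F s - F (1/2))"
    using s deriv nonneg by (intro nn_integral_FTC_Icc) auto
  also have "ennreal (f 0 * (1/2)) + \<dots> = ennreal (f 0 * (1/2) + (F s - F (1/2)))"
  proof (rule ennreal_plus[symmetric])
    show "0 \<le> f 0 * (1/2)" using nonneg[of 0] s by simp
    have "F (1/2) \<le> F s"
      using s deriv nonneg by (intro DERIV_nonneg_imp_nondecreasing[of _ _ F]) force+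
    thus "0 \<le> F s - F (1/2)" by simp
  qed
  finally show ?thesis by simp
qed

subsection \<open>Invariance of the coupling\<close>

context profile
begin

definition coupling :: "(ereal \<times> ereal) measure" where
  "coupling = distr joint (I_space \<Otimes>\<^sub>M I_space) (\<lambda>z. (unalpha (fst z), unalpha (snd z)))"

lemma sets_coupling [measurable_cong, simp]: "sets coupling = sets (I_space \<Otimes>\<^sub>M I_space)"
  by (simp add: coupling_def)

lemma space_coupling: "space coupling = I_set \<times> I_set"
  by (simp add: coupling_def space_pair_measure space_I_space)

lemma prob_space_coupling: "prob_space coupling"
  unfolding coupling_def by (intro prob_space.prob_space_distr prob_space_joint) simp

lemma emeasure_coupling:
  assumes [measurable]: "A \<in> sets I_space" "B \<in> sets I_space"
  shows "emeasure coupling (A \<times> B) = emeasure joint (unalpha -` A \<times> unalpha -` B)"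
  unfolding coupling_def by (subst emeasure_distr) (auto intro!: arg_cong[where f = "emeasure joint"])

lemma emeasure_coupling_commute:
  assumes [measurable]: "A \<in> sets I_space" "B \<in> sets I_space"
  shows "emeasure coupling (A \<times> B) = emeasure coupling (B \<times> A)"
proof -
  have "unalpha -` A \<in> sets borel" "unalpha -` B \<in> sets borel"
    using measurable_sets[OF unalpha_measurable assms(1)] measurable_sets[OF unalpha_measurable assms(2)] by simp_all
  thus ?thesis by (simp add: emeasure_coupling emeasure_joint_commute)
qed

text \<open>P(X <= a, Y <= b) in the coordinates of \<open>alpha\<close>. At a = b = 0 the quotient
  0 / 0 is 0 and the factor \<open>max a b\<close> removes the term.\<close>

definition lo :: "real \<Rightarrow> real \<Rightarrow> real" where
  "lo a b = max a b / 2 - max a b * \<phi> (min a b / max a b)"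

lemma lo_commute: "lo a b = lo b a"
  by (simp add: lo_def max.commute min.commute)

lemma emeasure_coupling_lower:
  assumes s: "0 \<le> s" "s \<le> 1" and t: "0 \<le> t" "t \<le> 1"
  shows "emeasure coupling (lower (ereal s) \<times> lower (ereal t)) = ennreal (lo (alpha s) (alpha t))"
proof -
  have *: "emeasure coupling (lower (ereal s) \<times> lower (ereal t)) = ennreal (lo (alpha s) (alpha t))"
    if "0 \<le> s" "s \<le> t" "t \<le> 1" for s t
    using that emeasure_joint_Iic[of "alpha s" "alpha t"] alpha_bounds[of s] alpha_mono[of s t]
    by (simp add: emeasure_coupling vimage_unalpha_lower lo_def max_absorb2 min_absorb1)
  show ?thesis
  proof (cases "s \<le> t")
    case False
    thus ?thesis using *[of t s] s t
      by (subst emeasure_coupling_commute) (simp_all add: lo_commute)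
  qed (use * s t in auto)
qed

lemma emeasure_coupling_lower_I:
  assumes s: "0 \<le> s" "s \<le> 1"
  shows "emeasure coupling (lower (ereal s) \<times> I_set) = ennreal (alpha s / 2)"
proof -
  have "I_set \<in> sets I_space" using lower_sets[of \<infinity>] by (simp add: lower_infinity)
  moreover have "unalpha -` I_set = UNIV" using unalpha_in_I_set by auto
  ultimately show ?thesis
    using emeasure_joint_Iic_UNIV[of "alpha s"] alpha_bounds[of s] s
    by (simp add: emeasure_coupling vimage_unalpha_lower)
qed

lemma emeasure_coupling_I_lower:
  assumes s: "0 \<le> s" "s \<le> 1"
  shows "emeasure coupling (I_set \<times> lower (ereal s)) = ennreal (alpha s / 2)"
proof -
  have "I_set \<in> sets I_space" using lower_sets[of \<infinity>] by (simp add: lower_infinity)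
  thus ?thesis using emeasure_coupling_lower_I[OF s] by (subst emeasure_coupling_commute) auto
qed

text \<open>By convexity \<phi>' <= \<phi>'(1) on the unit interval, and c <= 1/2 makes \<phi>'(1)
  nonpositive. Hence \<phi> stays below \<phi>(0) = 1/2 there.\<close>

lemma lo_nonneg: "0 \<le> a \<Longrightarrow> a \<le> b \<Longrightarrow> 0 \<le> lo a b"
proof -
  assume ab: "0 \<le> a" "a \<le> b"
  have "\<phi> (a / b) \<le> \<phi> 0"
  proof (rule DERIV_nonpos_imp_nonincreasing[of 0 "a / b" \<phi>])
    show "0 \<le> a / b" using ab by simp
    fix r assume r: "0 \<le> r" "r \<le> a / b"
    have "r \<le> 1" using r ab by (cases "b = 0") (auto intro: order_trans[OF r(2)])
    hence "d\<phi> r \<le> d\<phi> 1" by (rule dphi_mono)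
    thus "\<exists>y. (\<phi> has_real_derivative y) (at r) \<and> y \<le> 0"
      using has_deriv_phi[of r] c_le by (auto simp: dphi_1)
  qed
  hence "b * \<phi> (a / b) \<le> b * (1/2)" using ab by (intro mult_left_mono) (auto simp: phi_0)
  thus ?thesis using ab by (simp add: lo_def max_absorb2 min_absorb1)
qed

sublocale C: prob_space coupling by (rule prob_space_coupling)

lemma lower_I: "I_set \<in> sets I_space"
  using lower_sets[of \<infinity>] by (simp add: lower_infinity)

definition upper :: "real \<Rightarrow> ereal set" where "upper s = I_set - lower (ereal s)"

lemma upper_sets [measurable]: "upper s \<in> sets I_space"
  unfolding upper_def using lower_I by auto

text \<open>P(X > a, Y > b), that is 1 - a/2 - b/2 + lo a b after simplification.\<close>

definition tail :: "real \<Rightarrow> real \<Rightarrow> real" where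
  "tail a b = 1 - min a b / 2 - max a b * \<phi> (min a b / max a b)"

lemma tail_commute: "tail a b = tail b a"
  by (simp add: tail_def max.commute min.commute)

lemma lo_nonneg': "0 \<le> a \<Longrightarrow> 0 \<le> b \<Longrightarrow> 0 \<le> lo a b"
  using lo_nonneg[of a b] lo_nonneg[of b a] by (cases "a \<le> b") (auto simp: lo_commute)

lemma measure_coupling_upper:
  assumes s: "0 \<le> s" "s \<le> 1" and t: "0 \<le> t" "t \<le> 1"
  shows "measure coupling (upper s \<times> upper t) = tail (alpha s) (alpha t)"
proof -
  let ?A = "lower (ereal s) \<times> I_set" and ?B = "I_set \<times> lower (ereal t)"
  have [measurable]: "?A \<in> sets coupling" "?B \<in> sets coupling" using lower_I by auto
  have AB: "?A \<inter> ?B = lower (ereal s) \<times> lower (ereal t)" by (auto simp: lower_def)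
  have "upper s \<times> upper t = space coupling - (?A \<union> ?B)"
    by (auto simp: upper_def space_coupling)
  moreover have "?A \<union> ?B \<in> C.events"
    using \<open>?A \<in> sets coupling\<close> \<open>?B \<in> sets coupling\<close> by (rule sets.Un)
  ultimately have "measure coupling (upper s \<times> upper t) = 1 - measure coupling (?A \<union> ?B)"
    by (simp only: C.prob_compl)
  also have "measure coupling (?A \<union> ?B) = measure coupling ?A + measure coupling ?B - measure coupling (?A \<inter> ?B)"
    using \<open>?A \<in> sets coupling\<close> \<open>?B \<in> sets coupling\<close>
    by (intro measure_Un3) (simp_all only: C.fmeasurable_eq_sets)
  also have "measure coupling ?A = alpha s / 2"
    using alpha_bounds[of s] s by (simp add: measure_def emeasure_coupling_lower_I)
  also have "measure coupling ?B = alpha t / 2"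
    using alpha_bounds[of t] t by (simp add: measure_def emeasure_coupling_I_lower)
  also have "measure coupling (?A \<inter> ?B) = lo (alpha s) (alpha t)"
    unfolding AB using alpha_bounds[of s] alpha_bounds[of t] s t
    by (simp add: measure_def emeasure_coupling_lower lo_nonneg')
  finally show ?thesis by (simp add: tail_def lo_def min_def max_def)
qed

section \<open>One step of the recursion applied to two independent pairs with a common
  \<tau>\<close>

definition step :: "real \<times> (ereal \<times> ereal) \<times> (ereal \<times> ereal) \<Rightarrow> ereal \<times> ereal" where
  "step z = (gamma (fst z) (fst (fst (snd z))) (fst (snd (snd z))),
             gamma (fst z) (snd (fst (snd z))) (snd (snd (snd z))))"

lemma step_measurable [measurable]:
  "step \<in> uniform01 \<Otimes>\<^sub>M (coupling \<Otimes>\<^sub>M coupling) \<rightarrow>\<^sub>M I_space \<Otimes>\<^sub>M I_space"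
  unfolding step_def by measurable

definition evolved :: "(ereal \<times> ereal) measure" where
  "evolved = distr (uniform01 \<Otimes>\<^sub>M (coupling \<Otimes>\<^sub>M coupling)) (I_space \<Otimes>\<^sub>M I_space) step"

sublocale CC: pair_prob_space coupling coupling ..

lemma emeasure_evolved:
  assumes [measurable]: "A \<in> sets (I_space \<Otimes>\<^sub>M I_space)"
  shows "emeasure evolved A = (\<integral>\<^sup>+r. ennreal (measure (coupling \<Otimes>\<^sub>M coupling)
    {z \<in> space (coupling \<Otimes>\<^sub>M coupling). step (r, z) \<in> A}) * indicator {0..1} r \<partial>lborel)"
proof -
  have sp: "space (uniform01 \<Otimes>\<^sub>M (coupling \<Otimes>\<^sub>M coupling)) = space uniform01 \<times> space (coupling \<Otimes>\<^sub>M coupling)"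
    by (simp add: space_pair_measure)
  have "emeasure evolved A = emeasure (uniform01 \<Otimes>\<^sub>M (coupling \<Otimes>\<^sub>M coupling))
     (step -` A \<inter> space (uniform01 \<Otimes>\<^sub>M (coupling \<Otimes>\<^sub>M coupling)))"
    unfolding evolved_def by (rule emeasure_distr) measurable
  also have "\<dots> = (\<integral>\<^sup>+r. emeasure (coupling \<Otimes>\<^sub>M coupling)
     (Pair r -` (step -` A \<inter> space (uniform01 \<Otimes>\<^sub>M (coupling \<Otimes>\<^sub>M coupling)))) \<partial>uniform01)"
    by (rule CC.P.emeasure_pair_measure_alt) measurable
  also have "\<dots> = (\<integral>\<^sup>+r. ennreal (measure (coupling \<Otimes>\<^sub>M coupling)
    {z \<in> space (coupling \<Otimes>\<^sub>M coupling). step (r, z) \<in> A}) \<partial>uniform01)"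
    by (intro nn_integral_cong) (auto simp: sp CC.P.emeasure_eq_measure intro!: arg_cong[where f = "measure _"])
  finally show ?thesis unfolding nn_integral_uniform01 .
qed

lemma measure_upper_square:
  assumes "0 \<le> s" "s \<le> 1" "0 \<le> t" "t \<le> 1"
  shows "measure (coupling \<Otimes>\<^sub>M coupling) ((upper s \<times> upper t) \<times> (upper s \<times> upper t))
    = (tail (alpha s) (alpha t))\<^sup>2"
proof -
  have "emeasure (coupling \<Otimes>\<^sub>M coupling) ((upper s \<times> upper t) \<times> (upper s \<times> upper t))
    = ennreal (tail (alpha s) (alpha t)) * ennreal (tail (alpha s) (alpha t))"
    using assms by (subst C.emeasure_pair_measure_Times)
       (auto simp: C.emeasure_eq_measure measure_coupling_upper)
  moreover have "0 \<le> tail (alpha s) (alpha t)"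
    using measure_coupling_upper[OF assms] measure_nonneg by metis
  ultimately show ?thesis
    by (simp add: measure_def ennreal_mult[symmetric] power2_eq_square)
qed

text \<open>A minimum exceeds a level exactly when both children do, so independence of the children
  squares the joint tails. The event asks for minima in (r, s] and (r, t], and inclusion-exclusion
  writes it in terms of such squares.\<close>

lemma measure_between:
  assumes s: "0 \<le> s" "s \<le> 1" and t: "0 \<le> t" "t \<le> 1" and r: "0 \<le> r" "r \<le> s" "r \<le> t"
  shows "measure (coupling \<Otimes>\<^sub>M coupling)
      {z \<in> space (coupling \<Otimes>\<^sub>M coupling). step (r, z) \<in> lower (ereal s) \<times> lower (ereal t)}
    = (tail (alpha r) (alpha r))\<^sup>2 - (tail (alpha r) (alpha s))\<^sup>2
      - (tail (alpha r) (alpha t))\<^sup>2 + (tail (alpha s) (alpha t))\<^sup>2"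
proof -
  define T where "T = (\<lambda>s t. (upper s \<times> upper t) \<times> (upper s \<times> upper t))"
  have T_sets: "T s t \<in> CC.P.events" for s t unfolding T_def by measurable
  have g: "gamma r x y \<in> I_set" if "x \<in> I_set" "y \<in> I_set" for x y
    using that by (auto simp: gamma_def min_def I_set_def)
  have eq: "{z \<in> space (coupling \<Otimes>\<^sub>M coupling). step (r, z) \<in> lower (ereal s) \<times> lower (ereal t)}
     = T r r - (T s r \<union> T r t)"
  proof (rule set_eqI)
    fix z :: "(ereal \<times> ereal) \<times> (ereal \<times> ereal)"
    obtain x1 y1 x2 y2 where z: "z = ((x1, y1), (x2, y2))" by (metis surj_pair)
    show "z \<in> {z \<in> space (coupling \<Otimes>\<^sub>M coupling). step (r, z) \<in> lower (ereal s) \<times> lower (ereal t)} \<longleftrightarrow>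
      z \<in> T r r - (T s r \<union> T r t)"
    proof (cases "x1 \<in> I_set \<and> y1 \<in> I_set \<and> x2 \<in> I_set \<and> y2 \<in> I_set")
      case True
      have le: "ereal r < x" if "ereal s < x \<or> ereal t < x" for x
        using that r by (cases x) auto
      show ?thesis using True le[of x1] le[of x2] le[of y1] le[of y2] unfolding z
        by (simp add: space_pair_measure space_coupling step_def T_def upper_def lower_def g gamma_le_iff
            not_le min_le_iff_disj) (auto simp: not_le)
    next
      case False
      thus ?thesis unfolding z by (auto simp: space_pair_measure space_coupling T_def upper_def)
    qed
  qed
  have sub: "T s r \<union> T r t \<subseteq> T r r" "T s r \<inter> T r t = T s t"
  proof -
    have up: "upper s \<subseteq> upper r" "upper t \<subseteq> upper r"
      using r by (auto simp: upper_def lower_def intro: order_trans[of _ "ereal r"])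
    show "T s r \<union> T r t \<subseteq> T r r" "T s r \<inter> T r t = T s t"
      using up unfolding T_def by blast+
  qed
  have "measure (coupling \<Otimes>\<^sub>M coupling) (T r r - (T s r \<union> T r t)) =
    measure (coupling \<Otimes>\<^sub>M coupling) (T r r) - measure (coupling \<Otimes>\<^sub>M coupling) (T s r \<union> T r t)"
    by (intro CC.P.finite_measure_Diff T_sets sets.Un sub)
  also have "measure (coupling \<Otimes>\<^sub>M coupling) (T s r \<union> T r t) = measure (coupling \<Otimes>\<^sub>M coupling) (T s r)
     + measure (coupling \<Otimes>\<^sub>M coupling) (T r t) - measure (coupling \<Otimes>\<^sub>M coupling) (T s r \<inter> T r t)"
    by (intro measure_Un3) (simp_all only: CC.P.fmeasurable_eq_sets T_sets)
  also note sub(2)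
  finally show ?thesis
    unfolding eq T_def using s t r
    by (simp add: measure_upper_square tail_commute[of "alpha s" "alpha r"])
qed

lemma emeasure_evolved_lower:
  assumes s: "0 \<le> s" "s \<le> 1" and t: "0 \<le> t" "t \<le> 1"
  shows "emeasure evolved (lower (ereal s) \<times> lower (ereal t)) = (\<integral>\<^sup>+r. ennreal
     ((tail (alpha r) (alpha r))\<^sup>2 - (tail (alpha r) (alpha s))\<^sup>2
      - (tail (alpha r) (alpha t))\<^sup>2 + (tail (alpha s) (alpha t))\<^sup>2) * indicator {0..min s t} r \<partial>lborel)"
proof -
  have *: "{z \<in> space (coupling \<Otimes>\<^sub>M coupling). step (r, z) \<in> lower (ereal s) \<times> lower (ereal t)} = {}"
    if "min s t < r" for r
  proof -
    have less: "r < s'" if "gamma r x y \<le> ereal s'" for s' x y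
    proof -
      have "ereal r < ereal s'" using that unfolding gamma_le_iff by (meson less_le_trans)
      thus ?thesis by simp
    qed
    show ?thesis using that by (auto simp: step_def lower_def dest!: less)
  qed
  have "emeasure evolved (lower (ereal s) \<times> lower (ereal t)) = (\<integral>\<^sup>+r. ennreal (measure (coupling \<Otimes>\<^sub>M coupling)
    {z \<in> space (coupling \<Otimes>\<^sub>M coupling). step (r, z) \<in> lower (ereal s) \<times> lower (ereal t)}) * indicator {0..1} r \<partial>lborel)"
    by (rule emeasure_evolved) measurable
  also have "\<dots> = (\<integral>\<^sup>+r. ennreal
     ((tail (alpha r) (alpha r))\<^sup>2 - (tail (alpha r) (alpha s))\<^sup>2
      - (tail (alpha r) (alpha t))\<^sup>2 + (tail (alpha s) (alpha t))\<^sup>2) * indicator {0..min s t} r \<partial>lborel)"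
  proof (rule nn_integral_cong)
    fix r :: real
    consider "r < 0" | "0 \<le> r" "r \<le> min s t" | "min s t < r" by linarith
    thus "ennreal (measure (coupling \<Otimes>\<^sub>M coupling)
      {z \<in> space (coupling \<Otimes>\<^sub>M coupling). step (r, z) \<in> lower (ereal s) \<times> lower (ereal t)}) * indicator {0..1} r
      = ennreal ((tail (alpha r) (alpha r))\<^sup>2 - (tail (alpha r) (alpha s))\<^sup>2
      - (tail (alpha r) (alpha t))\<^sup>2 + (tail (alpha s) (alpha t))\<^sup>2) * indicator {0..min s t} r"
    proof cases
      case 2
      thus ?thesis using s t by (subst measure_between) auto
    next
      case 3
      have "indicator {0..min s t} r = (0 :: ennreal)" using 3 by (auto simp: indicator_def)
      thus ?thesis unfolding *[OF 3] by simp
    qed simp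
  qed
  finally show ?thesis .
qed

lemma alpha_ge_half: "1/2 \<le> r \<Longrightarrow> alpha r = 2 - 1 / r"
  by (auto simp: alpha_def field_simps)

lemma tail_0: "0 \<le> b \<Longrightarrow> tail 0 b = 1 - b / 2"
  by (simp add: tail_def phi_0 max_def min_def)

lemma alpha_borel [measurable]: "alpha \<in> borel_measurable borel"
  unfolding alpha_def[abs_def] by measurable

lemma tail_borel [measurable]: "(\<lambda>r. tail (alpha r) b) \<in> borel_measurable borel" "(\<lambda>r. tail (alpha r) (alpha r)) \<in> borel_measurable borel"
  unfolding tail_def by measurable

text \<open>The logarithms in the antiderivatives of the three \<open>r\<close>-dependent squares
  cancel precisely because \<open>\<kappa> = c/2 + c\<^sup>2\<close>.\<close>

lemma emeasure_evolved_lower_le: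
  assumes s: "0 \<le> s" "s \<le> t" "t \<le> 1"
  shows "emeasure evolved (lower (ereal s) \<times> lower (ereal t)) = ennreal (lo (alpha s) (alpha t))"
proof -
  define a where "a = alpha s"
  define b where "b = alpha t"
  define f where "f = (\<lambda>r. (tail (alpha r) (alpha r))\<^sup>2 - (tail (alpha r) a)\<^sup>2 - (tail (alpha r) b)\<^sup>2 + (tail a b)\<^sup>2)"
  have ab: "0 \<le> a" "a \<le> b" "b \<le> 1"
    using alpha_bounds[of s] alpha_bounds[of t] alpha_mono[of s t] s by (auto simp: a_def b_def)
  have f_nonneg: "0 \<le> f r" if "0 \<le> r" "r \<le> s" for r
  proof -
    have "f r = measure (coupling \<Otimes>\<^sub>M coupling)
      {z \<in> space (coupling \<Otimes>\<^sub>M coupling). step (r, z) \<in> lower (ereal s) \<times> lower (ereal t)}"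
      unfolding f_def a_def b_def using that s by (intro measure_between[symmetric]) auto
    thus ?thesis by simp
  qed
  have f_const: "f r = f 0" if "0 \<le> r" "r \<le> 1/2" for r
    using that by (simp add: f_def alpha_def)
  have "(\<integral>\<^sup>+r. ennreal (f r) * indicator {0..s} r \<partial>lborel) = ennreal (lo a b)"
  \<comment> \<open>Up to 1/2 the coordinate a is 0 and everything vanishes. Beyond it a > 0, so
    that the quotients by a and b in \<open>u\<close> are meaningful.\<close>
  proof (cases "s \<le> 1/2")
    case True
    have "f r = 0" if "0 \<le> r" "r \<le> s" for r
      using that True ab by (simp add: f_def a_def alpha_def tail_0)
    hence "(\<integral>\<^sup>+r. ennreal (f r) * indicator {0..s} r \<partial>lborel) = (\<integral>\<^sup>+r. 0 \<partial>(lborel :: real measure))"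
      by (intro nn_integral_cong) (auto simp: indicator_def)
    thus ?thesis using True ab by (simp add: a_def alpha_def lo_def phi_0 max_def min_def)
  next
    case False
    define u where "u = (\<lambda>b r. b * \<phi> ((2 - 1 / r) / b))"
    \<comment> \<open>Put x = 2 - 1/r. The profile equation gives (r u^2)' = u^2 + (\<kappa> x -
      u)/r, so -r u^2 absorbs the terms u/r - u^2 of a squared tail up to \<kappa> x / r. The two
      leftovers 2\<kappa> x / r combine with the diagonal square to c^2 x (x + 2/r) = c^2 (4 -
      1/r^2), besides a single -1/(4 r^2).\<close>
    define F where "F = (\<lambda>r. 1 / (4 * r) + c\<^sup>2 * (4 * r + 1 / r) - r * (u a r)\<^sup>2 - r * (u b r)\<^sup>2 + (tail a b)\<^sup>2 * r)"
    have a: "a = 2 - 1 / s" "0 < a" using False by (auto simp: a_def alpha_def field_simps)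
    have u: "((\<lambda>r. r * (u b r)\<^sup>2) has_real_derivative (u b r)\<^sup>2 + (\<kappa> * (2 - 1 / r) - u b r) / r) (at r)"
      if "0 < b" "0 < r" for b r
    proof -
      have p: "0 < \<phi> ((2 - 1 / r) / b)" by (rule phi_pos)
      have "((\<lambda>r. u b r) has_real_derivative b * (d\<phi> ((2 - 1 / r) / b) * (1 / r\<^sup>2 / b))) (at r)"
        unfolding u_def using that
        by (auto intro!: derivative_eq_intros DERIV_chain2[OF has_deriv_phi] simp: power2_eq_square)
      hence "((\<lambda>r. r * (u b r)\<^sup>2) has_real_derivative
          (u b r)\<^sup>2 + r * (2 * u b r * (b * (d\<phi> ((2 - 1 / r) / b) * (1 / r\<^sup>2 / b))))) (at r)"
        by (auto intro!: derivative_eq_intros)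
      moreover have "r * (2 * u b r * (b * (d\<phi> ((2 - 1 / r) / b) * (1 / r\<^sup>2 / b))))
          = (2 * b * (\<phi> ((2 - 1 / r) / b) * d\<phi> ((2 - 1 / r) / b))) / r"
        using that by (simp add: u_def power2_eq_square)
      moreover have "2 * (\<phi> x * d\<phi> x) = \<kappa> * x - \<phi> x" for x
        using phi_pos[of x] by (simp add: d\<phi>_def field_simps)
      from this[of "(2 - 1 / r) / b", symmetric]
      have "2 * b * (\<phi> ((2 - 1 / r) / b) * d\<phi> ((2 - 1 / r) / b)) = b * (\<kappa> * ((2 - 1 / r) / b) - \<phi> ((2 - 1 / r) / b))"
        by (simp only: mult_ac)
      moreover have "\<dots> = \<kappa> * (2 - 1 / r) - u b r"
      proof -
        have "b * (\<kappa> * (x / b) - y) = \<kappa> * x - b * y" for x y using that by (simp add: field_simps)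
        thus ?thesis unfolding u_def .
      qed
      ultimately show ?thesis by simp
    qed
    have tails: "tail (alpha r) b = 1 / (2 * r) - u b r" if "1/2 \<le> r" "2 - 1 / r \<le> b" "0 < b" for r b
    proof -
      have "alpha r = 2 - 1 / r" using that by (intro alpha_ge_half)
      thus ?thesis using that by (simp add: tail_def u_def max_absorb2 min_absorb1 diff_divide_distrib)
    qed
    have diag: "tail (alpha r) (alpha r) = 1 / (2 * r) - c * (2 - 1 / r)" if "1/2 \<le> r" for r
    proof -
      have "alpha r = 2 - 1 / r" using that by (intro alpha_ge_half)
      moreover have "tail x x = 1 - x / 2 - c * x" for x
        by (cases "x = 0") (simp_all add: tail_def phi_1)
      ultimately show ?thesis by (simp add: diff_divide_distrib)
    qed
    have "(\<integral>\<^sup>+r. ennreal (f r) * indicator {0..s} r \<partial>lborel) = ennreal (f 0 / 2 + (F s - F (1/2)))"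
    proof (rule nn_integral_two_pieces)
      show "1/2 \<le> s" using False by simp
      show "f \<in> borel_measurable borel" unfolding f_def by measurable
      fix r assume r: "1/2 \<le> r" "r \<le> s"
      have le1: "2 - 1 / r \<le> a" using r unfolding a by (auto simp: field_simps)
      note le = le1 order_trans[OF le1 ab(2)]
      have "(F has_real_derivative - 1 / (4 * r\<^sup>2) + c\<^sup>2 * (4 - 1 / r\<^sup>2)
         - ((u a r)\<^sup>2 + (\<kappa> * (2 - 1 / r) - u a r) / r)
         - ((u b r)\<^sup>2 + (\<kappa> * (2 - 1 / r) - u b r) / r) + (tail a b)\<^sup>2) (at r)"
        unfolding F_def
      proof (intro DERIV_add DERIV_diff)
        show "((\<lambda>r. 1 / (4 * r)) has_real_derivative - 1 / (4 * r\<^sup>2)) (at r)"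
          using r by (auto intro!: derivative_eq_intros simp: power2_eq_square)
        show "((\<lambda>r. c\<^sup>2 * (4 * r + 1 / r)) has_real_derivative c\<^sup>2 * (4 - 1 / r\<^sup>2)) (at r)"
          using r by (auto intro!: derivative_eq_intros simp: power2_eq_square)
        show "((\<lambda>r. (tail a b)\<^sup>2 * r) has_real_derivative (tail a b)\<^sup>2) (at r)"
          by (auto intro!: derivative_eq_intros)
      qed (use u[of a r] u[of b r] r a ab in auto)
      moreover have "f r = - 1 / (4 * r\<^sup>2) + c\<^sup>2 * (4 - 1 / r\<^sup>2)
         - ((u a r)\<^sup>2 + (\<kappa> * (2 - 1 / r) - u a r) / r)
         - ((u b r)\<^sup>2 + (\<kappa> * (2 - 1 / r) - u b r) / r) + (tail a b)\<^sup>2"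
      proof -
        define i where "i = 1 / r"
        have "1 / (4 * r\<^sup>2) = i\<^sup>2 / 4" "1 / r\<^sup>2 = i\<^sup>2" "1 / (2 * r) = i / 2" "x / r = x * i" "- 1 / (4 * r\<^sup>2) = - i\<^sup>2 / 4" for x
          by (simp_all add: i_def power2_eq_square)
        note i = this
        show ?thesis
          unfolding f_def diag[OF r(1)] tails[OF r(1) le(1) a(2)] tails[OF r(1) le(2) less_le_trans[OF a(2) ab(2)]]
            i kappa_def
          by (simp add: i_def[symmetric] algebra_simps power2_eq_square)
      qed
      ultimately show "(F has_real_derivative f r) (at r)" by simp
    next
      show "0 \<le> f r" if "0 \<le> r" "r \<le> s" for r using that by (rule f_nonneg)
      show "f r = f 0" if "0 \<le> r" "r \<le> 1/2" for r using that by (rule f_const)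
    qed
    also have "f 0 / 2 + (F s - F (1/2)) = lo a b"
    proof -
      have b0: "0 < b" using a ab by simp
      have us: "u a s = c * a" using a by (simp add: u_def phi_1)
      have u0: "u x (1/2) = x / 2" if "0 < x" for x using that by (simp add: u_def phi_0)
      have tl: "tail a b = 1 / (2 * s) - u b s" using tails[of s b] False ab a b0 by (simp add: a_def alpha_def)
      have lo: "lo a b = b / 2 - u b s" using ab a by (simp add: lo_def u_def max_absorb2 min_absorb1)
      have f0: "f 0 = 1 - (1 - a / 2)\<^sup>2 - (1 - b / 2)\<^sup>2 + (tail a b)\<^sup>2"
        using ab by (simp add: f_def alpha_def tail_0)
      have s0: "0 < s" using False by simp
      \<comment> \<open>This is b \<phi>(a/b), whose value is not explicit. Its square cancels
        between -s v^2 and s (tail a b)^2, and the halves of (tail a b)^2 in \<open>f 0 / 2\<close>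
        and \<open>F (1/2)\<close> cancel as well. Only the linear -v of \<open>lo\<close>
        survives.\<close>
      define v where "v = u b s"
      show ?thesis
      proof -
        define i where "i = 1 / s"
        have i: "1 / (4 * s) = i / 4" "1 / (2 * s) = i / 2" "1 / s = i" by (simp_all add: i_def)
        have si: "s * i = 1" using s0 by (simp add: i_def)
        have "s * (c * a)\<^sup>2 = c\<^sup>2 * (4 * s - 4 * (s * i) + (s * i) * i)"
          unfolding a(1) i by (simp add: algebra_simps power2_eq_square)
        moreover have "(i / 2 - v)\<^sup>2 * s = (s * i) * i / 4 - (s * i) * v + s * v\<^sup>2"
          by (simp add: algebra_simps power2_eq_square)
        ultimately have *: "s * (c * a)\<^sup>2 = c\<^sup>2 * (4 * s - 4 + i)" "(i / 2 - v)\<^sup>2 * s = i / 4 - v + s * v\<^sup>2"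
          by (simp_all add: si)
        have ai: "a = 2 - i" using a(1) by (simp add: i_def)
        show ?thesis
          unfolding f0 F_def us u0[OF a(2)] u0[OF b0] tl lo v_def[symmetric] i *
          by (simp add: ai algebra_simps power2_eq_square add_divide_distrib diff_divide_distrib)
      qed
    qed
    finally show ?thesis .
  qed
  thus ?thesis using emeasure_evolved_lower[of s t] s by (simp add: f_def a_def b_def min_absorb1)
qed

lemma emeasure_evolved_lower_eq:
  assumes s: "0 \<le> s" "s \<le> 1" and t: "0 \<le> t" "t \<le> 1"
  shows "emeasure evolved (lower (ereal s) \<times> lower (ereal t)) = ennreal (lo (alpha s) (alpha t))"
proof (cases "s \<le> t")
  case False
  have "emeasure evolved (lower (ereal s) \<times> lower (ereal t)) = emeasure evolved (lower (ereal t) \<times> lower (ereal s))"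
    unfolding emeasure_evolved_lower[OF s t] emeasure_evolved_lower[OF t s]
      min.commute[of s t] tail_commute[of "alpha s" "alpha t"]
    by (intro nn_integral_cong) (simp add: algebra_simps)
  thus ?thesis using emeasure_evolved_lower_le[of t s] False s t by (simp add: lo_commute)
qed (use emeasure_evolved_lower_le s t in auto)

lemma measure_coupling_marginal: "0 \<le> s \<Longrightarrow> s \<le> 1 \<Longrightarrow> measure coupling (upper s \<times> I_set) = 1 - alpha s / 2"
  "0 \<le> s \<Longrightarrow> s \<le> 1 \<Longrightarrow> measure coupling (I_set \<times> upper s) = 1 - alpha s / 2"
proof -
  assume s: "0 \<le> s" "s \<le> 1"
  have m: "lower (ereal s) \<times> I_set \<in> C.events" "I_set \<times> lower (ereal s) \<in> C.events"
    using lower_I by auto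
  have "upper s \<times> I_set = space coupling - lower (ereal s) \<times> I_set"
    "I_set \<times> upper s = space coupling - I_set \<times> lower (ereal s)"
    by (auto simp: upper_def space_coupling)
  thus "measure coupling (upper s \<times> I_set) = 1 - alpha s / 2"
    "measure coupling (I_set \<times> upper s) = 1 - alpha s / 2"
    using alpha_bounds[of s] s C.prob_compl[OF m(1)] C.prob_compl[OF m(2)]
    by (simp_all only: measure_def emeasure_coupling_lower_I emeasure_coupling_I_lower) simp_all
qed

text \<open>The one-dimensional fixed point property of \<nu>, computed from its tail 1/(2r). The
  function \<open>f\<close> stands for either projection, so that one computation covers both
  marginals.\<close>

lemma emeasure_evolved_marginal:
  assumes f: "f \<in> coupling \<rightarrow>\<^sub>M I_space"
    and tails: "\<And>s. 0 \<le> s \<Longrightarrow> s \<le> 1 \<Longrightarrow> measure coupling (f -` upper s \<inter> space coupling) = 1 - alpha s / 2"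
    and s: "0 \<le> s" "s \<le> 1" and A: "A \<in> sets (I_space \<Otimes>\<^sub>M I_space)"
    and A_iff: "\<And>r x y. x \<in> space coupling \<Longrightarrow> y \<in> space coupling \<Longrightarrow>
      step (r, x, y) \<in> A \<longleftrightarrow> gamma r (f x) (f y) \<in> lower (ereal s)"
  shows "emeasure evolved A = ennreal (alpha s / 2)"
proof -
  define B where "B = (\<lambda>s. f -` upper s \<inter> space coupling)"
  have B_sets: "B s \<in> sets coupling" for s unfolding B_def using f by (rule measurable_sets) simp
  have BB_sets: "B s \<times> B s \<in> CC.P.events" for s using B_sets by (intro pair_measureI)
  have BB: "measure (coupling \<Otimes>\<^sub>M coupling) (B r \<times> B r) = (1 - alpha r / 2)\<^sup>2" if "0 \<le> r" "r \<le> 1" for r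
  proof -
    have "emeasure (coupling \<Otimes>\<^sub>M coupling) (B r \<times> B r) = ennreal (1 - alpha r / 2) * ennreal (1 - alpha r / 2)"
      unfolding C.emeasure_pair_measure_Times[OF B_sets B_sets]
      using tails[OF that] by (simp only: C.emeasure_eq_measure B_def)
    thus ?thesis using alpha_bounds[of r] that
      by (simp add: measure_def ennreal_mult[symmetric] power2_eq_square)
  qed
  define g where "g = (\<lambda>r. (1 - alpha r / 2)\<^sup>2 - (1 - alpha s / 2)\<^sup>2)"
  have le: "ereal r < x" if "r \<le> s" "ereal s < x" for r x using that by (cases x) auto
  have fI: "f x \<in> I_set" if "x \<in> space coupling" for x
    using measurable_space[OF f that] by (simp add: space_I_space)
  have gI: "gamma r x y \<in> I_set" if "x \<in> I_set" "y \<in> I_set" for r x y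
    using that by (auto simp: gamma_def min_def I_set_def)
  have between: "measure (coupling \<Otimes>\<^sub>M coupling) {z \<in> space (coupling \<Otimes>\<^sub>M coupling). step (r, z) \<in> A} = g r"
    if r: "0 \<le> r" "r \<le> s" for r
  proof -
    have "{z \<in> space (coupling \<Otimes>\<^sub>M coupling). step (r, z) \<in> A} = B r \<times> B r - B s \<times> B s"
    proof (rule set_eqI)
      fix z :: "(ereal \<times> ereal) \<times> (ereal \<times> ereal)"
      obtain x y where z: "z = (x, y)" by (cases z)
      show "z \<in> {z \<in> space (coupling \<Otimes>\<^sub>M coupling). step (r, z) \<in> A} \<longleftrightarrow> z \<in> B r \<times> B r - B s \<times> B s"
      proof (cases "x \<in> space coupling \<and> y \<in> space coupling")
        case True
        thus ?thesis using fI[of x] fI[of y] unfolding z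
          by (simp add: space_pair_measure B_def A_iff upper_def lower_def gI gamma_le_iff min_le_iff_disj)
             (auto simp: not_le)
      next
        case False
        thus ?thesis unfolding z by (auto simp: space_pair_measure B_def)
      qed
    qed
    moreover have "B s \<times> B s \<subseteq> B r \<times> B r"
      using r by (auto simp: B_def upper_def lower_def intro: order_trans[of _ "ereal r"])
    ultimately show ?thesis
      using r s by (simp only: CC.P.finite_measure_Diff BB_sets) (simp add: BB g_def)
  qed
  have above: "{z \<in> space (coupling \<Otimes>\<^sub>M coupling). step (r, z) \<in> A} = {}" if "s < r" for r
  proof -
    have "\<not> gamma r x y \<le> ereal s" for x y
    proof
      assume "gamma r x y \<le> ereal s"
      hence "ereal r < ereal s" unfolding gamma_le_iff by (meson less_le_trans)
      thus False using that by simp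
    qed
    thus ?thesis by (auto simp: space_pair_measure A_iff lower_def)
  qed
  have "emeasure evolved A = (\<integral>\<^sup>+r. ennreal (measure (coupling \<Otimes>\<^sub>M coupling)
    {z \<in> space (coupling \<Otimes>\<^sub>M coupling). step (r, z) \<in> A}) * indicator {0..1} r \<partial>lborel)"
    by (rule emeasure_evolved) fact
  also have "\<dots> = (\<integral>\<^sup>+r. ennreal (g r) * indicator {0..s} r \<partial>lborel)"
  proof (rule nn_integral_cong)
    fix r :: real
    consider "r < 0" | "0 \<le> r" "r \<le> s" | "s < r" by linarith
    thus "ennreal (measure (coupling \<Otimes>\<^sub>M coupling) {z \<in> space (coupling \<Otimes>\<^sub>M coupling). step (r, z) \<in> A}) * indicator {0..1} r
      = ennreal (g r) * indicator {0..s} r"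
    proof cases
      case 2
      thus ?thesis using s by (simp add: between)
    next
      case 3
      show ?thesis unfolding above[OF 3] using 3 by simp
    qed simp
  qed
  also have "\<dots> = ennreal (alpha s / 2)"
  proof (cases "s \<le> 1/2")
    case True
    hence "g r = 0" if "0 \<le> r" "r \<le> s" for r using that by (simp add: g_def alpha_def)
    hence "(\<integral>\<^sup>+r. ennreal (g r) * indicator {0..s} r \<partial>lborel) = (\<integral>\<^sup>+r. 0 \<partial>(lborel :: real measure))"
      by (intro nn_integral_cong) (auto simp: indicator_def)
    thus ?thesis using True by (simp add: alpha_def)
  next
    case False
    define F where "F = (\<lambda>r. - 1 / (4 * r) - (1 / (2 * s))\<^sup>2 * r)"
    have g: "g r = (1 / (2 * r))\<^sup>2 - (1 / (2 * s))\<^sup>2" if "1/2 \<le> r" for r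
      using alpha_ge_half[OF that] alpha_ge_half[of s] False by (simp add: g_def diff_divide_distrib mult.commute)
    have "(\<integral>\<^sup>+r. ennreal (g r) * indicator {0..s} r \<partial>lborel) = ennreal (g 0 / 2 + (F s - F (1/2)))"
    proof (rule nn_integral_two_pieces)
      show "g \<in> borel_measurable borel" unfolding g_def by measurable
      show "0 \<le> g r" if "0 \<le> r" "r \<le> s" for r unfolding between[OF that, symmetric] by simp
      show "g r = g 0" if "0 \<le> r" "r \<le> 1/2" for r using that by (simp add: g_def alpha_def)
      show "(F has_real_derivative g r) (at r)" if "1/2 \<le> r" "r \<le> s" for r
        unfolding g[OF that(1)] F_def using that
        by (auto intro!: derivative_eq_intros simp: power2_eq_square)
    qed (use False in auto)
    also have "g 0 = g (1/2)" by (simp add: g_def alpha_def)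
    also have "g (1/2) / 2 + (F s - F (1/2)) = alpha s / 2"
    proof -
      have "(1 / (2 * s))\<^sup>2 * s = 1 / (4 * s)" using False by (simp add: power2_eq_square)
      thus ?thesis using False alpha_ge_half[of s] by (simp add: g F_def diff_divide_distrib)
    qed
    finally show ?thesis .
  qed
  finally show ?thesis .
qed

text \<open>Rectangles with a full side only see the invariance of \<nu>. The profile equation
  enters through the remaining ones.\<close>

lemma evolved_eq_coupling: "evolved = coupling"
proof (rule measure_eqI_lower)
  show "prob_space evolved"
    unfolding evolved_def
  proof (rule prob_space.prob_space_distr)
    interpret U: prob_space uniform01 by (rule prob_space_uniform01)
    interpret UC: pair_prob_space uniform01 "coupling \<Otimes>\<^sub>M coupling" ..
    show "prob_space (uniform01 \<Otimes>\<^sub>M (coupling \<Otimes>\<^sub>M coupling))" by (rule UC.prob_space_axioms)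
  qed measurable
  have sp: "space (coupling \<Otimes>\<^sub>M coupling) = (I_set \<times> I_set) \<times> (I_set \<times> I_set)"
    by (simp add: space_pair_measure space_coupling)
  have gI: "gamma r x y \<in> I_set" if "x \<in> I_set" "y \<in> I_set" for r x y
    using that by (auto simp: gamma_def min_def I_set_def)
  fix s :: real assume s: "s \<in> {0..1}"
  have "emeasure evolved (lower (ereal s) \<times> I_set) = ennreal (alpha s / 2)"
  proof (rule emeasure_evolved_marginal)
    show "fst \<in> coupling \<rightarrow>\<^sub>M I_space" by simp
    show "measure coupling (fst -` upper s \<inter> space coupling) = 1 - alpha s / 2" if "0 \<le> s" "s \<le> 1" for s
    proof -
      have "fst -` upper s \<inter> space coupling = upper s \<times> I_set" by (auto simp: space_coupling upper_def)
      thus ?thesis using measure_coupling_marginal(1)[OF that] by simp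
    qed
    show "lower (ereal s) \<times> I_set \<in> sets (I_space \<Otimes>\<^sub>M I_space)" using lower_I by auto
  qed (use s in \<open>auto simp: step_def space_coupling gI\<close>)
  thus "emeasure evolved (lower (ereal s) \<times> I_set) = emeasure coupling (lower (ereal s) \<times> I_set)"
    using s by (simp add: emeasure_coupling_lower_I)
  have "emeasure evolved (I_set \<times> lower (ereal s)) = ennreal (alpha s / 2)"
  proof (rule emeasure_evolved_marginal)
    show "snd \<in> coupling \<rightarrow>\<^sub>M I_space" by simp
    show "measure coupling (snd -` upper s \<inter> space coupling) = 1 - alpha s / 2" if "0 \<le> s" "s \<le> 1" for s
    proof -
      have "snd -` upper s \<inter> space coupling = I_set \<times> upper s" by (auto simp: space_coupling upper_def)
      thus ?thesis using measure_coupling_marginal(2)[OF that] by simp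
    qed
    show "I_set \<times> lower (ereal s) \<in> sets (I_space \<Otimes>\<^sub>M I_space)" using lower_I by auto
  qed (use s in \<open>auto simp: step_def space_coupling gI\<close>)
  thus "emeasure evolved (I_set \<times> lower (ereal s)) = emeasure coupling (I_set \<times> lower (ereal s))"
    using s by (simp add: emeasure_coupling_I_lower)
next
  fix s t :: real assume st: "s \<in> {0..1}" "t \<in> {0..1}"
  show "emeasure evolved (lower (ereal s) \<times> lower (ereal t)) = emeasure coupling (lower (ereal s) \<times> lower (ereal t))"
    using st by (simp add: emeasure_evolved_lower_eq emeasure_coupling_lower)
qed (simp_all add: prob_space_coupling evolved_def)

section \<open>Marginals and off-diagonal mass of the coupling\<close>

lemma has_nu_tailsI:
  assumes "sets N = sets I_space" "prob_space N"
    and "\<And>t. 0 \<le> t \<Longrightarrow> t \<le> 1 \<Longrightarrow> measure N (upper t) = 1 - alpha t / 2"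
  shows "N = nu"
proof (rule has_nu_tails_unique[OF _ has_nu_tails_nu])
  interpret N: prob_space N by fact
  show "has_nu_tails N"
    unfolding has_nu_tails_def
  proof (intro conjI ballI)
    fix t :: real assume t: "t \<in> {0..1}"
    have "upper t = {ereal t<..} \<inter> I_set" by (auto simp: upper_def lower_def not_le)
    hence "{ereal t<..1} \<union> {\<infinity>} = upper t"
      using t I_set_tail[of t] by simp
    hence eq: "emeasure N ({ereal t<..1} \<union> {\<infinity>}) = ennreal (1 - alpha t / 2)"
      using assms(3)[of t] t by (simp add: N.emeasure_eq_measure)
    show "emeasure N ({ereal t<..1} \<union> {\<infinity>}) = min 1 (1 / (2 * ennreal t))"
    proof (cases "t = 0")
      case True
      thus ?thesis unfolding eq by (simp add: alpha_def divide_ennreal_def)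
    next
      case False
      have "2 * ennreal t = ennreal (2 * t)" using t ennreal_mult[of 2 t] by simp
      hence "1 / (2 * ennreal t) = ennreal (1 / (2 * t))"
        using False t divide_ennreal[of 1 "2 * t"] by (simp only: ennreal_1) simp
      moreover have "min 1 (ennreal x) = ennreal (min 1 x)" for x
        by (cases "x \<le> 1") (auto simp: min_def)
      moreover have "1 - alpha t / 2 = min 1 (1 / (2 * t))"
        using False t by (auto simp: alpha_def min_def field_simps)
      ultimately show ?thesis unfolding eq by simp
    qed
  qed fact+
qed

lemma distr_coupling_fst: "distr coupling I_space fst = nu"
proof (rule has_nu_tailsI)
  fix t :: real assume t: "0 \<le> t" "t \<le> 1"
  have "fst -` upper t \<inter> space coupling = upper t \<times> I_set" by (auto simp: space_coupling upper_def)
  thus "measure (distr coupling I_space fst) (upper t) = 1 - alpha t / 2"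
    using measure_coupling_marginal(1)[OF t] by (simp add: measure_distr)
qed (auto intro!: C.prob_space_distr)

lemma distr_coupling_snd: "distr coupling I_space snd = nu"
proof (rule has_nu_tailsI)
  fix t :: real assume t: "0 \<le> t" "t \<le> 1"
  have "snd -` upper t \<inter> space coupling = I_set \<times> upper t" by (auto simp: space_coupling upper_def)
  thus "measure (distr coupling I_space snd) (upper t) = 1 - alpha t / 2"
    using measure_coupling_marginal(2)[OF t] by (simp add: measure_distr)
qed (auto intro!: C.prob_space_distr)

text \<open>Y is finite with probability 1/2 and both are finite with probability 1/2 - \<phi>(1);
  the gap is c.\<close>

lemma coupling_off_diagonal: "measure coupling ({\<infinity>} \<times> (I_set - {\<infinity>})) = c"
proof -
  have l: "lower (ereal 1) = I_set - {\<infinity>}" by (auto simp: lower_def I_set_def one_ereal_def)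
  have "measure coupling (I_set \<times> lower (ereal 1) - lower (ereal 1) \<times> lower (ereal 1)) =
    measure coupling (I_set \<times> lower (ereal 1)) - measure coupling (lower (ereal 1) \<times> lower (ereal 1))"
  proof (rule C.finite_measure_Diff)
    show "I_set \<times> lower (ereal 1) \<in> C.events" "lower (ereal 1) \<times> lower (ereal 1) \<in> C.events"
      using lower_I by auto
  qed (auto simp: lower_def)
  also have "\<dots> = c"
  proof -
    have "emeasure coupling (I_set \<times> lower (ereal 1)) = ennreal (1/2)"
      by (subst emeasure_coupling_I_lower) (simp_all add: alpha_def)
    moreover have "emeasure coupling (lower (ereal 1) \<times> lower (ereal 1)) = ennreal (1/2 - c)"
      by (subst emeasure_coupling_lower) (simp_all add: alpha_def lo_def phi_1)
    ultimately have "measure coupling (I_set \<times> lower (ereal 1)) = 1/2"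
      "measure coupling (lower (ereal 1) \<times> lower (ereal 1)) = 1/2 - c"
      using c_le unfolding measure_def by (simp_all only: enn2real_ennreal)
    thus ?thesis by simp
  qed
  also have "I_set \<times> lower (ereal 1) - lower (ereal 1) \<times> lower (ereal 1) = {\<infinity>} \<times> (I_set - {\<infinity>})"
    unfolding l by (auto simp: I_set_def)
  finally show ?thesis .
qed

end

subsection \<open>Finite trees\<close>

text \<open>Sets that finite blocks of coordinates approximate in measure include the one-coordinate
  cylinders, where the error is 0, and are closed under complements and countable unions. This
  replaces a function of all \<tau> by an event that a finite tree can test.\<close>

lemma cylinder_approximation:
  fixes N :: "'i \<Rightarrow> 'b measure" and U :: "nat \<Rightarrow> 'i set"
  assumes Q: "prob_space Q" and sets_Q: "sets Q = sets (PiM UNIV N)"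
    and U: "incseq U" "(\<Union>n. U n) = UNIV"
    and S: "S \<in> sets Q" and \<epsilon>: "0 < \<epsilon>"
  shows "\<exists>n. \<exists>B\<in>sets (PiM (U n) N). measure Q {\<omega>\<in>space Q. (\<omega> \<in> S) \<noteq> (restrict \<omega> (U n) \<in> B)} < \<epsilon>"
proof -
  interpret Q: prob_space Q by fact
  have sp: "space Q = space (PiM UNIV N)" using sets_eq_imp_space_eq[OF sets_Q] .
  have res: "(\<lambda>\<omega>. restrict \<omega> (U n)) \<in> Q \<rightarrow>\<^sub>M PiM (U n) N" for n
    unfolding measurable_cong_sets[OF sets_Q refl] by (rule measurable_restrict_subset) simp
  have diff_sets: "{\<omega>\<in>space Q. (\<omega> \<in> S) \<noteq> (restrict \<omega> (U n) \<in> B)} \<in> sets Q"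
    if "S \<in> sets Q" "B \<in> sets (PiM (U n) N)" for S B n
  proof -
    have [measurable]: "{\<omega>\<in>space Q. restrict \<omega> (U n) \<in> B} \<in> sets Q"
      using measurable_sets[OF res that(2)] by (simp add: vimage_def Int_def conj_commute)
    have "{\<omega>\<in>space Q. (\<omega> \<in> S) \<noteq> (restrict \<omega> (U n) \<in> B)} =
      (S - {\<omega>\<in>space Q. restrict \<omega> (U n) \<in> B}) \<union> ({\<omega>\<in>space Q. restrict \<omega> (U n) \<in> B} - S)"
      using sets.sets_into_space[OF that(1)] by auto
    thus ?thesis using that(1) by simp
  qed
  have "S \<in> sigma_sets (\<Pi>\<^sub>E i\<in>UNIV. space (N i)) {{f\<in>\<Pi>\<^sub>E i\<in>UNIV. space (N i). f i \<in> A} | i A. i \<in> UNIV \<and> A \<in> sets (N i)}"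
    using S unfolding sets_Q sets_PiM_single .
  thus ?thesis using \<epsilon>
  proof (induction arbitrary: \<epsilon> rule: sigma_sets.induct)
    case (Basic a)
    then obtain i A where a: "a = {f\<in>\<Pi>\<^sub>E i\<in>UNIV. space (N i). f i \<in> A}" and A: "A \<in> sets (N i)" by auto
    obtain n where n: "i \<in> U n" using U by blast
    let ?B = "{f\<in>space (PiM (U n) N). f i \<in> A}"
    have "?B \<in> sets (PiM (U n) N)"
      using measurable_sets[OF measurable_component_singleton[OF n, of N] A] by (simp add: vimage_def Int_def conj_commute)
    moreover have "{\<omega>\<in>space Q. (\<omega> \<in> a) \<noteq> (restrict \<omega> (U n) \<in> ?B)} = {}"
      using n by (auto simp: a sp space_PiM PiE_iff)
    hence "measure Q {\<omega>\<in>space Q. (\<omega> \<in> a) \<noteq> (restrict \<omega> (U n) \<in> ?B)} < \<epsilon>"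
      using Basic.prems by (simp only: measure_empty)
    ultimately show ?case by blast
  next
    case Empty
    show ?case using Empty by (intro exI[of _ 0] bexI[of _ "{}"]) auto
  next
    case (Compl a)
    from Compl.IH[OF Compl.prems] obtain n B where B: "B \<in> sets (PiM (U n) N)"
      "measure Q {\<omega>\<in>space Q. (\<omega> \<in> a) \<noteq> (restrict \<omega> (U n) \<in> B)} < \<epsilon>" by blast
    have "{\<omega>\<in>space Q. (\<omega> \<in> (\<Pi>\<^sub>E i\<in>UNIV. space (N i)) - a) \<noteq> (restrict \<omega> (U n) \<in> space (PiM (U n) N) - B)}
      = {\<omega>\<in>space Q. (\<omega> \<in> a) \<noteq> (restrict \<omega> (U n) \<in> B)}"
      by (auto simp: sp space_PiM PiE_iff)
    hence "measure Q {\<omega>\<in>space Q. (\<omega> \<in> (\<Pi>\<^sub>E i\<in>UNIV. space (N i)) - a) \<noteq> (restrict \<omega> (U n) \<in> space (PiM (U n) N) - B)} < \<epsilon>"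
      using B(2) by simp
    moreover have "space (PiM (U n) N) - B \<in> sets (PiM (U n) N)" using B(1) by auto
    ultimately show ?case by blast
  next
    case (Union a)
    have a_sets: "a i \<in> sets Q" for i
      using Union.hyps unfolding sets_Q sets_PiM_single by simp
    have "(\<lambda>m. measure Q (\<Union>i<m. a i)) \<longlonglongrightarrow> measure Q (\<Union>m. \<Union>i<m. a i)"
    proof (rule Q.finite_Lim_measure_incseq)
      show "incseq (\<lambda>m. \<Union>i<m. a i)" by (intro monoI) force
    qed (use a_sets in auto)
    moreover have un: "(\<Union>m. \<Union>i<m. a i) = (\<Union>i. a i)" by auto
    ultimately have "eventually (\<lambda>m. measure Q (\<Union>i. a i) - \<epsilon>/2 < measure Q (\<Union>i<m. a i)) sequentially"
      using Union.prems by (intro order_tendstoD(1)) auto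
    then obtain m where m: "measure Q (\<Union>i. a i) - \<epsilon>/2 < measure Q (\<Union>i<m. a i)"
      by (auto simp: eventually_sequentially)
    \<comment> \<open>Half of \<epsilon> pays for cutting the union at m, the other half is shared
      by the m approximations. The + 1 covers m = 0 and keeps the bound strict.\<close>
    define \<delta> where "\<delta> = \<epsilon> / (2 * (real m + 1))"
    have \<delta>: "0 < \<delta>" "real m * \<delta> < \<epsilon> / 2" using Union.prems by (auto simp: \<delta>_def field_simps)
    have "\<forall>i. \<exists>n. \<exists>B\<in>sets (PiM (U n) N). measure Q {\<omega>\<in>space Q. (\<omega> \<in> a i) \<noteq> (restrict \<omega> (U n) \<in> B)} < \<delta>"
      using Union.IH \<delta>(1) by blast
    from choice[OF this] obtain n where
      "\<forall>i. \<exists>B\<in>sets (PiM (U (n i)) N). measure Q {\<omega>\<in>space Q. (\<omega> \<in> a i) \<noteq> (restrict \<omega> (U (n i)) \<in> B)} < \<delta>" ..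
    from choice[OF this[unfolded Bex_def]] obtain B where B: "\<And>i. B i \<in> sets (PiM (U (n i)) N)"
      "\<And>i. measure Q {\<omega>\<in>space Q. (\<omega> \<in> a i) \<noteq> (restrict \<omega> (U (n i)) \<in> B i)} < \<delta>" by blast
    define k where "k = Max (insert 0 (n ` {..<m}))"
    have nk: "n i \<le> k" if "i < m" for i unfolding k_def using that by (intro Max_ge) auto
    have Uk: "U (n i) \<subseteq> U k" if "i < m" for i using U(1) nk[OF that] by (auto simp: incseq_def)
    define C where "C = (\<Union>i<m. {f\<in>space (PiM (U k) N). restrict f (U (n i)) \<in> B i})"
    have C: "C \<in> sets (PiM (U k) N)"
      unfolding C_def
    proof (intro sets.finite_UN)
      fix i assume "i \<in> {..<m}"
      hence "(\<lambda>f. restrict f (U (n i))) \<in> PiM (U k) N \<rightarrow>\<^sub>M PiM (U (n i)) N"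
        using Uk by (intro measurable_restrict_subset) auto
      from measurable_sets[OF this B(1)[of i]]
      show "{f\<in>space (PiM (U k) N). restrict f (U (n i)) \<in> B i} \<in> sets (PiM (U k) N)"
        by (simp add: vimage_def Int_def conj_commute)
    qed simp
    have C_iff: "restrict \<omega> (U k) \<in> C \<longleftrightarrow> (\<exists>i<m. restrict \<omega> (U (n i)) \<in> B i)" if "\<omega> \<in> space Q" for \<omega>
    proof -
      have "restrict \<omega> (U k) \<in> space (PiM (U k) N)" using that by (auto simp: sp space_PiM PiE_iff)
      moreover have "restrict (restrict \<omega> (U k)) (U (n i)) = restrict \<omega> (U (n i))" if "i < m" for i
        using Uk[OF that] by (simp add: restrict_restrict Int_absorb1)
      ultimately show ?thesis unfolding C_def by auto
    qed
    define E where "E = (\<lambda>i. {\<omega>\<in>space Q. (\<omega> \<in> a i) \<noteq> (restrict \<omega> (U (n i)) \<in> B i)})"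
    have E_sets: "E i \<in> sets Q" for i unfolding E_def by (rule diff_sets[OF a_sets B(1)])
    have R: "(\<Union>i. a i) - (\<Union>i<m. a i) \<in> sets Q" using a_sets by auto
    have "measure Q {\<omega>\<in>space Q. (\<omega> \<in> (\<Union>i. a i)) \<noteq> (restrict \<omega> (U k) \<in> C)}
       \<le> measure Q (((\<Union>i. a i) - (\<Union>i<m. a i)) \<union> (\<Union>i<m. E i))"
      using R E_sets by (intro Q.finite_measure_mono) (auto simp: C_iff E_def)
    also have "\<dots> \<le> measure Q ((\<Union>i. a i) - (\<Union>i<m. a i)) + measure Q (\<Union>i<m. E i)"
      using R E_sets by (intro measure_Un_le) auto
    also have "measure Q ((\<Union>i. a i) - (\<Union>i<m. a i)) = measure Q (\<Union>i. a i) - measure Q (\<Union>i<m. a i)"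
      using a_sets by (intro Q.finite_measure_Diff) auto
    also have "measure Q (\<Union>i<m. E i) \<le> (\<Sum>i<m. measure Q (E i))"
      using E_sets by (intro Q.finite_measure_subadditive_finite) auto
    also have "\<dots> \<le> (\<Sum>i<m. \<delta>)"
      using B(2) by (intro sum_mono) (auto simp: E_def intro: less_imp_le)
    also have "\<dots> = real m * \<delta>" by simp
    finally have "measure Q {\<omega>\<in>space Q. (\<omega> \<in> (\<Union>i. a i)) \<noteq> (restrict \<omega> (U k) \<in> C)} < \<epsilon>"
      using m \<delta> by linarith
    thus ?case using C by (intro exI[of _ k] bexI[of _ C])
  qed
qed

text \<open>The recursion truncated n levels below \<open>w\<close>, with the values of
  \<open>x\<close> inserted there. For a solution of the recursion the result does not depend on
  n.\<close>

primrec tree_eval :: "nat \<Rightarrow> (word \<Rightarrow> real) \<Rightarrow> (word \<Rightarrow> ereal) \<Rightarrow> word \<Rightarrow> ereal" where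
  "tree_eval 0 t x w = x w"
| "tree_eval (Suc n) t x w = gamma (t w) (tree_eval n t x (w @ [Letter1])) (tree_eval n t x (w @ [Letter2]))"

lemma tree_eval_cong:
  assumes "\<And>v. prefix w v \<Longrightarrow> length v < length w + n \<Longrightarrow> t v = t' v"
    and "\<And>v. prefix w v \<Longrightarrow> length v = length w + n \<Longrightarrow> x v = x' v"
  shows "tree_eval n t x w = tree_eval n t' x' w"
  using assms
proof (induction n arbitrary: w)
  case (Suc n)
  have "tree_eval n t x (w @ [a]) = tree_eval n t' x' (w @ [a])" for a
    by (rule Suc.IH; rule Suc.prems) (auto dest: append_prefixD)
  thus ?case using Suc.prems(1)[of w] by simp
qed simp

lemma measurable_tree_eval:
  assumes "\<And>v. prefix w v \<Longrightarrow> length v < length w + n \<Longrightarrow> (\<lambda>\<omega>. t \<omega> v) \<in> M \<rightarrow>\<^sub>M unit_space"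
    and "\<And>v. prefix w v \<Longrightarrow> length v = length w + n \<Longrightarrow> (\<lambda>\<omega>. x \<omega> v) \<in> M \<rightarrow>\<^sub>M I_space"
  shows "(\<lambda>\<omega>. tree_eval n (t \<omega>) (x \<omega>) w) \<in> M \<rightarrow>\<^sub>M I_space"
  using assms
proof (induction n arbitrary: w)
  case (Suc n)
  have "(\<lambda>\<omega>. tree_eval n (t \<omega>) (x \<omega>) (w @ [a])) \<in> M \<rightarrow>\<^sub>M I_space" for a
    by (rule Suc.IH; rule Suc.prems) (auto dest: append_prefixD)
  thus ?case using Suc.prems(1)[of w] by (simp add: measurable_gamma)
qed simp

definition trunk :: "nat \<Rightarrow> word set" where "trunk n = {w. length w < n}"
definition layer :: "nat \<Rightarrow> word set" where "layer n = {w. length w = n}"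

lemma finite_words: "finite {w :: word. length w \<le> n}"
proof -
  have "(UNIV :: letter set) = {Letter1, Letter2}" using letter.exhaust by auto
  hence "finite (UNIV :: letter set)" by (metis finite.emptyI finite.insertI)
  thus ?thesis using finite_lists_length_le[of UNIV n] by simp
qed

lemma finite_trunk: "finite (trunk n)"
  by (rule finite_subset[OF _ finite_words[of n]]) (auto simp: trunk_def)

lemma rooted_subtree_trunk: "rooted_subtree (trunk n)"
  by (auto simp: rooted_subtree_def trunk_def dest!: prefix_length_le)

lemma boundary_trunk: "boundary (trunk (Suc n)) = layer (Suc n)"
proof -
  have iff: "w \<in> trunk (Suc n) \<and> w @ [a] \<notin> trunk (Suc n) \<longleftrightarrow> length w = n" for w a
    by (auto simp: trunk_def)
  have "[] \<in> trunk (Suc n)" by (simp add: trunk_def)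
  hence "trunk (Suc n) \<noteq> {}" by blast
  hence "boundary (trunk (Suc n)) = {w @ [a] | w a. length w = n}"
    by (simp add: boundary_def iff)
  also have "\<dots> = layer (Suc n)"
    unfolding layer_def length_Suc_conv_rev by auto
  finally show ?thesis .
qed

text \<open>Depths start at 1 because the criterion that equates independence with a product law
  requires a nonempty index set.\<close>

lemma trunk_nonempty: "trunk (Suc n) \<noteq> {}"
  by (auto simp: trunk_def intro: exI[of _ "[]"])

lemma layer_nonempty: "layer n \<noteq> {}"
  unfolding layer_def using length_replicate[of n Letter1] by blast

text \<open>Formulated for arbitrary families, since it is applied both to the given process and to
  each coordinate of the coupled forest. That both get the same product law is what transports
  probabilities between the two spaces.\<close>

lemma (in prob_space) joint_law:
  fixes t :: "word \<Rightarrow> 'a \<Rightarrow> real" and x :: "word \<Rightarrow> 'a \<Rightarrow> ereal"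
  assumes t: "\<And>w. t w \<in> M \<rightarrow>\<^sub>M unit_space" "\<And>w. distr M unit_space (t w) = uniform01"
    and x: "\<And>w. x w \<in> M \<rightarrow>\<^sub>M I_space" "\<And>w. w \<in> V \<Longrightarrow> distr M I_space (x w) = nu"
    and indep_t: "indep_vars (\<lambda>_. unit_space) t UNIV" and indep_x: "indep_vars (\<lambda>_. I_space) x V"
    and U: "U \<noteq> {}" and V: "V \<noteq> {}"
    and indep: "\<And>A B. A \<in> sets (\<Pi>\<^sub>M i\<in>U. unit_space) \<Longrightarrow> B \<in> sets (\<Pi>\<^sub>M i\<in>V. I_space) \<Longrightarrow>
      prob ((\<lambda>\<omega>. (\<lambda>w\<in>U. t w \<omega>, \<lambda>w\<in>V. x w \<omega>)) -` (A \<times> B) \<inter> space M) =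
      prob ((\<lambda>\<omega>. \<lambda>w\<in>U. t w \<omega>) -` A \<inter> space M) * prob ((\<lambda>\<omega>. \<lambda>w\<in>V. x w \<omega>) -` B \<inter> space M)"
  shows "distr M ((\<Pi>\<^sub>M i\<in>U. unit_space) \<Otimes>\<^sub>M (\<Pi>\<^sub>M i\<in>V. I_space)) (\<lambda>\<omega>. (\<lambda>w\<in>U. t w \<omega>, \<lambda>w\<in>V. x w \<omega>))
    = (\<Pi>\<^sub>M i\<in>U. uniform01) \<Otimes>\<^sub>M (\<Pi>\<^sub>M i\<in>V. nu)"
proof -
  have [measurable]: "(\<lambda>\<omega>. \<lambda>w\<in>U. t w \<omega>) \<in> M \<rightarrow>\<^sub>M (\<Pi>\<^sub>M i\<in>U. unit_space)"
    by (intro measurable_restrict t)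
  have [measurable]: "(\<lambda>\<omega>. \<lambda>w\<in>V. x w \<omega>) \<in> M \<rightarrow>\<^sub>M (\<Pi>\<^sub>M i\<in>V. I_space)"
    by (intro measurable_restrict x)
  have dt: "distr M (\<Pi>\<^sub>M i\<in>U. unit_space) (\<lambda>\<omega>. \<lambda>w\<in>U. t w \<omega>) = (\<Pi>\<^sub>M i\<in>U. uniform01)"
  proof -
    have "indep_vars (\<lambda>_. unit_space) t U" using indep_t by (rule indep_vars_subset) simp
    thus ?thesis using indep_vars_iff_distr_eq_PiM'[OF U, where M' = "\<lambda>_. unit_space" and X = t] t by simp
  qed
  have dx: "distr M (\<Pi>\<^sub>M i\<in>V. I_space) (\<lambda>\<omega>. \<lambda>w\<in>V. x w \<omega>) = (\<Pi>\<^sub>M i\<in>V. nu)"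
    using indep_vars_iff_distr_eq_PiM'[OF V, where M' = "\<lambda>_. I_space" and X = x] indep_x x
    by (simp cong: PiM_cong)
  have "distr M (\<Pi>\<^sub>M i\<in>U. unit_space) (\<lambda>\<omega>. \<lambda>w\<in>U. t w \<omega>) \<Otimes>\<^sub>M distr M (\<Pi>\<^sub>M i\<in>V. I_space) (\<lambda>\<omega>. \<lambda>w\<in>V. x w \<omega>)
    = distr M ((\<Pi>\<^sub>M i\<in>U. unit_space) \<Otimes>\<^sub>M (\<Pi>\<^sub>M i\<in>V. I_space)) (\<lambda>\<omega>. (\<lambda>w\<in>U. t w \<omega>, \<lambda>w\<in>V. x w \<omega>))"
  proof (rule pair_measure_eqI)
    show "sigma_finite_measure (distr M (\<Pi>\<^sub>M i\<in>U. unit_space) (\<lambda>\<omega>. \<lambda>w\<in>U. t w \<omega>))"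
      by (intro prob_space_imp_sigma_finite prob_space_distr) measurable
    show "sigma_finite_measure (distr M (\<Pi>\<^sub>M i\<in>V. I_space) (\<lambda>\<omega>. \<lambda>w\<in>V. x w \<omega>))"
      by (intro prob_space_imp_sigma_finite prob_space_distr) measurable
  next
    fix A B
    assume "A \<in> sets (distr M (\<Pi>\<^sub>M i\<in>U. unit_space) (\<lambda>\<omega>. \<lambda>w\<in>U. t w \<omega>))"
      and "B \<in> sets (distr M (\<Pi>\<^sub>M i\<in>V. I_space) (\<lambda>\<omega>. \<lambda>w\<in>V. x w \<omega>))"
    hence AB [measurable]: "A \<in> sets (\<Pi>\<^sub>M i\<in>U. unit_space)" "B \<in> sets (\<Pi>\<^sub>M i\<in>V. I_space)" by simp_all
    show "emeasure (distr M (\<Pi>\<^sub>M i\<in>U. unit_space) (\<lambda>\<omega>. \<lambda>w\<in>U. t w \<omega>)) A *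
        emeasure (distr M (\<Pi>\<^sub>M i\<in>V. I_space) (\<lambda>\<omega>. \<lambda>w\<in>V. x w \<omega>)) B =
      emeasure (distr M ((\<Pi>\<^sub>M i\<in>U. unit_space) \<Otimes>\<^sub>M (\<Pi>\<^sub>M i\<in>V. I_space)) (\<lambda>\<omega>. (\<lambda>w\<in>U. t w \<omega>, \<lambda>w\<in>V. x w \<omega>))) (A \<times> B)"
      using indep[OF AB]
      by (simp add: emeasure_distr emeasure_eq_measure ennreal_mult[symmetric])
  qed simp
  thus ?thesis unfolding dt dx by simp
qed

subsection \<open>Coupled trees and nonendogeny\<close>

text \<open>The truncated root reads \<tau> only on the trunk and the leaves only on the layer, so
  the mismatch event is the preimage of a set in the product space and its probability is determined
  by the law \<open>N\<close>.\<close>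

lemma (in prob_space) measure_mismatch:
  fixes t :: "word \<Rightarrow> 'a \<Rightarrow> real" and x :: "word \<Rightarrow> 'a \<Rightarrow> ereal" and n :: nat
  defines "U \<equiv> trunk n" and "V \<equiv> layer n"
  assumes t: "\<And>w. t w \<in> M \<rightarrow>\<^sub>M unit_space" and x: "\<And>w. x w \<in> M \<rightarrow>\<^sub>M I_space"
    and law: "distr M ((\<Pi>\<^sub>M i\<in>U. unit_space) \<Otimes>\<^sub>M (\<Pi>\<^sub>M i\<in>V. I_space)) (\<lambda>\<omega>. (\<lambda>w\<in>U. t w \<omega>, \<lambda>w\<in>V. x w \<omega>)) = N"
    and B: "B \<in> sets (\<Pi>\<^sub>M i\<in>U. unit_space)"
  shows "prob {\<omega>\<in>space M. (tree_eval n (\<lambda>w. t w \<omega>) (\<lambda>w. x w \<omega>) [] = \<infinity>) \<noteq> ((\<lambda>w\<in>U. t w \<omega>) \<in> B)}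
    = measure N {z\<in>space N. (tree_eval n (fst z) (snd z) [] = \<infinity>) \<noteq> (fst z \<in> B)}"
    and "{\<omega>\<in>space M. (tree_eval n (\<lambda>w. t w \<omega>) (\<lambda>w. x w \<omega>) [] = \<infinity>) \<noteq> ((\<lambda>w\<in>U. t w \<omega>) \<in> B)} \<in> events"
proof -
  let ?K = "(\<Pi>\<^sub>M i\<in>U. unit_space) \<Otimes>\<^sub>M (\<Pi>\<^sub>M i\<in>V. I_space)"
  let ?f = "\<lambda>\<omega>. (\<lambda>w\<in>U. t w \<omega>, \<lambda>w\<in>V. x w \<omega>)"
  let ?Z = "{z\<in>space ?K. (tree_eval n (fst z) (snd z) [] = \<infinity>) \<noteq> (fst z \<in> B)}"
  have f: "?f \<in> M \<rightarrow>\<^sub>M ?K"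
    by (intro measurable_Pair measurable_restrict t x)
  have ev: "(\<lambda>z. tree_eval n (fst z) (snd z) []) \<in> ?K \<rightarrow>\<^sub>M I_space"
  proof (rule measurable_tree_eval)
    fix v :: word
    show "(\<lambda>z. fst z v) \<in> ?K \<rightarrow>\<^sub>M unit_space" if "length v < length [] + n"
      using that by (intro measurable_compose[OF measurable_fst] measurable_component_singleton) (simp add: U_def trunk_def)
    show "(\<lambda>z. snd z v) \<in> ?K \<rightarrow>\<^sub>M I_space" if "length v = length [] + n"
      using that by (intro measurable_compose[OF measurable_snd] measurable_component_singleton) (simp add: V_def layer_def)
  qed
  have Z: "?Z \<in> sets ?K"
  proof -
    note [measurable] = I_space_borel[OF ev] B
    show ?thesis by measurable
  qed
  have eq: "?f -` ?Z \<inter> space M = {\<omega>\<in>space M. (tree_eval n (\<lambda>w. t w \<omega>) (\<lambda>w. x w \<omega>) [] = \<infinity>) \<noteq> ((\<lambda>w\<in>U. t w \<omega>) \<in> B)}"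
  proof -
    have "tree_eval n (\<lambda>w\<in>U. t w \<omega>) (\<lambda>w\<in>V. x w \<omega>) [] = tree_eval n (\<lambda>w. t w \<omega>) (\<lambda>w. x w \<omega>) []" for \<omega>
      by (rule tree_eval_cong) (simp_all add: U_def V_def trunk_def layer_def)
    thus ?thesis using measurable_space[OF f] by auto
  qed
  have "space N = space ?K" unfolding law[symmetric] by simp
  hence "measure N {z\<in>space N. (tree_eval n (fst z) (snd z) [] = \<infinity>) \<noteq> (fst z \<in> B)} = measure N ?Z" by simp
  also have "\<dots> = prob (?f -` ?Z \<inter> space M)"
    unfolding law[symmetric] by (rule measure_distr[OF f Z])
  finally show "prob {\<omega>\<in>space M. (tree_eval n (\<lambda>w. t w \<omega>) (\<lambda>w. x w \<omega>) [] = \<infinity>) \<noteq> ((\<lambda>w\<in>U. t w \<omega>) \<in> B)}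
    = measure N {z\<in>space N. (tree_eval n (fst z) (snd z) [] = \<infinity>) \<noteq> (fst z \<in> B)}"
    unfolding eq by simp
  show "{\<omega>\<in>space M. (tree_eval n (\<lambda>w. t w \<omega>) (\<lambda>w. x w \<omega>) [] = \<infinity>) \<noteq> ((\<lambda>w\<in>U. t w \<omega>) \<in> B)} \<in> events"
    using measurable_sets[OF f Z] unfolding eq .
qed

lemma indep_vars_PiM_coordinates:
  assumes "\<And>i. prob_space (N i)"
  shows "prob_space.indep_vars (PiM UNIV N) N (\<lambda>i \<omega>. \<omega> i) UNIV"
proof -
  interpret P: prob_space "PiM UNIV N" using assms by (intro prob_space_PiM)
  have "distr (PiM UNIV N) (PiM UNIV N) (\<lambda>\<omega>. \<lambda>i\<in>UNIV. \<omega> i) = PiM UNIV N"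
    unfolding restrict_UNIV by (rule distr_id)
  also have "\<dots> = (\<Pi>\<^sub>M i\<in>UNIV. distr (PiM UNIV N) (N i) (\<lambda>\<omega>. \<omega> i))"
    using assms by (intro PiM_cong refl distr_PiM_component[symmetric]) auto
  finally show ?thesis
    by (subst P.indep_vars_iff_distr_eq_PiM') auto
qed

lemma indep_PiM_restrict:
  assumes N: "\<And>i. prob_space (N i)" and DE: "D \<inter> E = {}"
    and f: "f \<in> PiM D N \<rightarrow>\<^sub>M L" and g: "g \<in> PiM E N \<rightarrow>\<^sub>M K" and A: "A \<in> sets L" and B: "B \<in> sets K"
  shows "measure (PiM UNIV N) ((\<lambda>\<omega>. (f (restrict \<omega> D), g (restrict \<omega> E))) -` (A \<times> B) \<inter> space (PiM UNIV N))
    = measure (PiM UNIV N) ((\<lambda>\<omega>. f (restrict \<omega> D)) -` A \<inter> space (PiM UNIV N))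
    * measure (PiM UNIV N) ((\<lambda>\<omega>. g (restrict \<omega> E)) -` B \<inter> space (PiM UNIV N))"
proof -
  interpret P: prob_space "PiM UNIV N" using N by (intro prob_space_PiM)
  have ind: "P.indep_var (PiM D N) (\<lambda>\<omega>. restrict \<omega> D) (PiM E N) (\<lambda>\<omega>. restrict \<omega> E)"
    using P.indep_var_restrict[OF indep_vars_PiM_coordinates[OF N] DE] by simp
  have sp: "restrict \<omega> D \<in> space (PiM D N)" "restrict \<omega> E \<in> space (PiM E N)" if "\<omega> \<in> space (PiM UNIV N)" for \<omega>
    using that by (auto simp: space_PiM PiE_iff)
  have eqs: "(\<lambda>\<omega>. (restrict \<omega> D, restrict \<omega> E)) -` ((f -` A \<inter> space (PiM D N)) \<times> (g -` B \<inter> space (PiM E N))) \<inter> space (PiM UNIV N)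
      = (\<lambda>\<omega>. (f (restrict \<omega> D), g (restrict \<omega> E))) -` (A \<times> B) \<inter> space (PiM UNIV N)"
    "(\<lambda>\<omega>. restrict \<omega> D) -` (f -` A \<inter> space (PiM D N)) \<inter> space (PiM UNIV N)
      = (\<lambda>\<omega>. f (restrict \<omega> D)) -` A \<inter> space (PiM UNIV N)"
    "(\<lambda>\<omega>. restrict \<omega> E) -` (g -` B \<inter> space (PiM E N)) \<inter> space (PiM UNIV N)
      = (\<lambda>\<omega>. g (restrict \<omega> E)) -` B \<inter> space (PiM UNIV N)"
    using sp by auto
  show ?thesis
    using P.indep_varD[OF ind measurable_sets[OF f A] measurable_sets[OF g B]] unfolding eqs .
qed

text \<open>Functions of disjoint blocks of coordinates are independent. The blocks will be the
  subtrees of two siblings, and then a vertex against both subtrees.\<close>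

lemma distr_PiM_restrict_pair:
  assumes N: "\<And>i. prob_space (N i)" and DE: "D \<inter> E = {}"
    and f: "f \<in> PiM D N \<rightarrow>\<^sub>M L" and g: "g \<in> PiM E N \<rightarrow>\<^sub>M K"
  shows "distr (PiM UNIV N) (L \<Otimes>\<^sub>M K) (\<lambda>\<omega>. (f (restrict \<omega> D), g (restrict \<omega> E)))
    = distr (PiM UNIV N) L (\<lambda>\<omega>. f (restrict \<omega> D)) \<Otimes>\<^sub>M distr (PiM UNIV N) K (\<lambda>\<omega>. g (restrict \<omega> E))"
proof -
  interpret P: prob_space "PiM UNIV N" using N by (intro prob_space_PiM)
  have f': "(\<lambda>\<omega>. f (restrict \<omega> D)) \<in> PiM UNIV N \<rightarrow>\<^sub>M L"
    by (rule measurable_compose[OF measurable_restrict_subset f]) simp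
  have g': "(\<lambda>\<omega>. g (restrict \<omega> E)) \<in> PiM UNIV N \<rightarrow>\<^sub>M K"
    by (rule measurable_compose[OF measurable_restrict_subset g]) simp
  have fg: "(\<lambda>\<omega>. (f (restrict \<omega> D), g (restrict \<omega> E))) \<in> PiM UNIV N \<rightarrow>\<^sub>M L \<Otimes>\<^sub>M K"
    using f' g' by (rule measurable_Pair)
  show ?thesis
  proof (rule pair_measure_eqI[symmetric])
    show "sigma_finite_measure (distr (PiM UNIV N) L (\<lambda>\<omega>. f (restrict \<omega> D)))"
      by (intro prob_space_imp_sigma_finite P.prob_space_distr f')
    show "sigma_finite_measure (distr (PiM UNIV N) K (\<lambda>\<omega>. g (restrict \<omega> E)))"
      by (intro prob_space_imp_sigma_finite P.prob_space_distr g')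
    fix A B
    assume "A \<in> sets (distr (PiM UNIV N) L (\<lambda>\<omega>. f (restrict \<omega> D)))"
      and "B \<in> sets (distr (PiM UNIV N) K (\<lambda>\<omega>. g (restrict \<omega> E)))"
    hence A: "A \<in> sets L" and B: "B \<in> sets K" by simp_all
    show "emeasure (distr (PiM UNIV N) L (\<lambda>\<omega>. f (restrict \<omega> D))) A *
        emeasure (distr (PiM UNIV N) K (\<lambda>\<omega>. g (restrict \<omega> E))) B =
      emeasure (distr (PiM UNIV N) (L \<Otimes>\<^sub>M K) (\<lambda>\<omega>. (f (restrict \<omega> D), g (restrict \<omega> E)))) (A \<times> B)"
      unfolding emeasure_distr[OF f' A] emeasure_distr[OF g' B] emeasure_distr[OF fg pair_measureI[OF A B]]
        P.emeasure_eq_measure indep_PiM_restrict[OF N DE f g A B]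
      by (simp add: ennreal_mult)
  qed simp
qed

context profile
begin

definition site :: "(real \<times> ereal \<times> ereal) measure" where "site = uniform01 \<Otimes>\<^sub>M coupling"

text \<open>Every word carries its own pair, although an evaluation to depth n uses only the pairs n
  levels down. One product space therefore serves all depths.\<close>

definition forest :: "(word \<Rightarrow> real \<times> ereal \<times> ereal) measure" where "forest = (\<Pi>\<^sub>M i\<in>UNIV. site)"

definition pair_eval :: "nat \<Rightarrow> word \<Rightarrow> (word \<Rightarrow> real \<times> ereal \<times> ereal) \<Rightarrow> ereal \<times> ereal" where
  "pair_eval n w \<omega> =
     (tree_eval n (\<lambda>v. fst (\<omega> v)) (\<lambda>v. fst (snd (\<omega> v))) w,
      tree_eval n (\<lambda>v. fst (\<omega> v)) (\<lambda>v. snd (snd (\<omega> v))) w)"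

lemma prob_space_site: "prob_space site"
proof -
  interpret U: prob_space uniform01 by (rule prob_space_uniform01)
  interpret UC: pair_prob_space uniform01 coupling ..
  show ?thesis unfolding site_def by (rule UC.prob_space_axioms)
qed

sublocale F: prob_space forest
  unfolding forest_def by (intro prob_space_PiM prob_space_site)

lemma site_fst: "fst \<in> site \<rightarrow>\<^sub>M unit_space"
  unfolding site_def by simp

lemma site_snd: "snd \<in> site \<rightarrow>\<^sub>M coupling"
  unfolding site_def by simp

lemma forest_component: "(\<lambda>\<omega>. \<omega> w) \<in> forest \<rightarrow>\<^sub>M site"
  unfolding forest_def by (rule measurable_component_singleton) simp

lemma distr_forest: "distr forest site (\<lambda>\<omega>. \<omega> w) = site"
  unfolding forest_def by (rule distr_PiM_component) (simp_all add: prob_space_site)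

lemma distr_site_fst: "distr site unit_space fst = uniform01"
proof -
  have "distr site unit_space fst = distr (uniform01 \<Otimes>\<^sub>M coupling) uniform01 fst"
    unfolding site_def by (rule distr_cong) simp_all
  thus ?thesis by (simp add: C.distr_pair_fst)
qed

lemma distr_site_snd: "distr site coupling snd = coupling"
proof (rule measure_eqI)
  interpret U: prob_space uniform01 by (rule prob_space_uniform01)
  fix A assume "A \<in> sets (distr site coupling snd)"
  hence A: "A \<in> sets coupling" by simp
  have "snd -` A \<inter> space site = space uniform01 \<times> A"
    using sets.sets_into_space[OF A] by (auto simp: site_def space_pair_measure)
  moreover have "emeasure site (space uniform01 \<times> A) = emeasure coupling A"
    unfolding site_def C.emeasure_pair_measure_Times[OF sets.top A] U.emeasure_space_1 by simp
  ultimately show "emeasure (distr site coupling snd) A = emeasure coupling A"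
    by (simp only: emeasure_distr[OF site_snd A])
qed simp

lemma pair_eval_restrict:
  assumes "{v. prefix w v} \<subseteq> D"
  shows "pair_eval n w (restrict \<omega> D) = pair_eval n w \<omega>"
  unfolding pair_eval_def using assms by (intro arg_cong2[where f = Pair] tree_eval_cong) auto

lemma pair_eval_measurable:
  assumes "{v. prefix w v} \<subseteq> D"
  shows "pair_eval n w \<in> (\<Pi>\<^sub>M i\<in>D. site) \<rightarrow>\<^sub>M coupling"
proof -
  have comp: "(\<lambda>\<omega>. \<omega> v) \<in> (\<Pi>\<^sub>M i\<in>D. site) \<rightarrow>\<^sub>M site" if "prefix w v" for v
    using assms that by (intro measurable_component_singleton) auto
  have sn: "(\<lambda>\<omega>. fst (snd (\<omega> v))) \<in> (\<Pi>\<^sub>M i\<in>D. site) \<rightarrow>\<^sub>M I_space"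
     "(\<lambda>\<omega>. snd (snd (\<omega> v))) \<in> (\<Pi>\<^sub>M i\<in>D. site) \<rightarrow>\<^sub>M I_space" if "prefix w v" for v
    using measurable_compose[OF comp[OF that] site_snd]
    unfolding measurable_cong_sets[OF refl sets_coupling]
    by (auto intro: measurable_compose[OF _ measurable_fst] measurable_compose[OF _ measurable_snd])
  have "pair_eval n w \<in> (\<Pi>\<^sub>M i\<in>D. site) \<rightarrow>\<^sub>M I_space \<Otimes>\<^sub>M I_space"
    unfolding pair_eval_def[abs_def]
    by (intro measurable_Pair measurable_tree_eval sn measurable_compose[OF comp site_fst])
  thus ?thesis unfolding measurable_cong_sets[OF refl sets_coupling] .
qed

text \<open>Invariance iterated up the tree: the children are evaluated on disjoint subtrees, hence
  are independent pairs with the coupling as law, and are independent of the common \<tau> at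
  \<open>w\<close>.\<close>

lemma distr_pair_eval: "distr forest coupling (pair_eval n w) = coupling"
proof (induction n arbitrary: w)
  case 0
  have "pair_eval 0 w = (\<lambda>\<omega>. snd (\<omega> w))" by (auto simp: pair_eval_def)
  hence "distr forest coupling (pair_eval 0 w) = distr (distr forest site (\<lambda>\<omega>. \<omega> w)) coupling snd"
    by (simp add: distr_distr[OF site_snd forest_component] comp_def)
  thus ?case by (simp add: distr_forest distr_site_snd)
next
  case (Suc n)
  define w1 where "w1 = w @ [Letter1]"
  define w2 where "w2 = w @ [Letter2]"
  define D1 where "D1 = {v. prefix w1 v}"
  define D2 where "D2 = {v. prefix w2 v}"
  have D12: "D1 \<inter> D2 = {}" by (auto simp: D1_def D2_def w1_def w2_def prefix_def)
  have D0: "{w} \<inter> (D1 \<union> D2) = {}" by (auto simp: D1_def D2_def w1_def w2_def prefix_def)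
  have m1: "pair_eval n w1 \<in> (\<Pi>\<^sub>M i\<in>D. site) \<rightarrow>\<^sub>M coupling" if "D1 \<subseteq> D" for D
    using that by (intro pair_eval_measurable) (simp add: D1_def)
  have m2: "pair_eval n w2 \<in> (\<Pi>\<^sub>M i\<in>D. site) \<rightarrow>\<^sub>M coupling" if "D2 \<subseteq> D" for D
    using that by (intro pair_eval_measurable) (simp add: D2_def)
  have r1: "pair_eval n w1 (restrict \<omega> D) = pair_eval n w1 \<omega>" if "D1 \<subseteq> D" for \<omega> D
    using that by (intro pair_eval_restrict) (simp add: D1_def)
  have r2: "pair_eval n w2 (restrict \<omega> D) = pair_eval n w2 \<omega>" if "D2 \<subseteq> D" for \<omega> D
    using that by (intro pair_eval_restrict) (simp add: D2_def)
  have children: "distr forest (coupling \<Otimes>\<^sub>M coupling) (\<lambda>\<omega>. (pair_eval n w1 \<omega>, pair_eval n w2 \<omega>))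
    = coupling \<Otimes>\<^sub>M coupling"
    using distr_PiM_restrict_pair[of "\<lambda>_. site", OF prob_space_site D12 m1[OF order_refl] m2[OF order_refl]]
    by (simp add: r1 r2 forest_def[symmetric] Suc.IH)
  have "(\<lambda>\<omega>. fst (\<omega> w)) \<in> (\<Pi>\<^sub>M i\<in>{w}. site) \<rightarrow>\<^sub>M uniform01"
    unfolding measurable_cong_sets[OF refl sets_uniform01]
    by (rule measurable_compose[OF measurable_component_singleton[of w "{w}" "\<lambda>_. site"] site_fst]) simp
  moreover have "(\<lambda>\<omega>. (pair_eval n w1 \<omega>, pair_eval n w2 \<omega>)) \<in> (\<Pi>\<^sub>M i\<in>D1 \<union> D2. site) \<rightarrow>\<^sub>M coupling \<Otimes>\<^sub>M coupling"
    by (intro measurable_Pair m1 m2) auto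
  ultimately have "distr forest (uniform01 \<Otimes>\<^sub>M (coupling \<Otimes>\<^sub>M coupling))
       (\<lambda>\<omega>. (fst (\<omega> w), pair_eval n w1 \<omega>, pair_eval n w2 \<omega>))
    = distr forest uniform01 (\<lambda>\<omega>. fst (\<omega> w)) \<Otimes>\<^sub>M (coupling \<Otimes>\<^sub>M coupling)"
    using distr_PiM_restrict_pair[of "\<lambda>_. site" "{w}" "D1 \<union> D2" "\<lambda>\<omega>. fst (\<omega> w)" uniform01
        "\<lambda>\<omega>. (pair_eval n w1 \<omega>, pair_eval n w2 \<omega>)" "coupling \<Otimes>\<^sub>M coupling", OF prob_space_site D0]
    by (simp add: r1 r2 forest_def[symmetric] children)
  also have "distr forest uniform01 (\<lambda>\<omega>. fst (\<omega> w)) = uniform01"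
  proof -
    have "distr forest uniform01 (\<lambda>\<omega>. fst (\<omega> w)) = distr forest unit_space (\<lambda>\<omega>. fst (\<omega> w))"
      by (rule distr_cong) simp_all
    also have "\<dots> = distr (distr forest site (\<lambda>\<omega>. \<omega> w)) unit_space fst"
      by (simp add: distr_distr[OF site_fst forest_component] comp_def)
    finally show ?thesis by (simp add: distr_forest distr_site_fst)
  qed
  finally have triple: "distr forest (uniform01 \<Otimes>\<^sub>M (coupling \<Otimes>\<^sub>M coupling))
       (\<lambda>\<omega>. (fst (\<omega> w), pair_eval n w1 \<omega>, pair_eval n w2 \<omega>)) = uniform01 \<Otimes>\<^sub>M (coupling \<Otimes>\<^sub>M coupling)" .
  have meas: "(\<lambda>\<omega>. (fst (\<omega> w), pair_eval n w1 \<omega>, pair_eval n w2 \<omega>))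
      \<in> forest \<rightarrow>\<^sub>M uniform01 \<Otimes>\<^sub>M (coupling \<Otimes>\<^sub>M coupling)"
  proof (intro measurable_Pair)
    show "(\<lambda>\<omega>. fst (\<omega> w)) \<in> forest \<rightarrow>\<^sub>M uniform01"
      unfolding measurable_cong_sets[OF refl sets_uniform01] by (rule measurable_compose[OF forest_component site_fst])
    show "pair_eval n w1 \<in> forest \<rightarrow>\<^sub>M coupling" "pair_eval n w2 \<in> forest \<rightarrow>\<^sub>M coupling"
      unfolding forest_def by (auto intro: m1 m2)
  qed
  have step: "pair_eval (Suc n) w = step \<circ> (\<lambda>\<omega>. (fst (\<omega> w), pair_eval n w1 \<omega>, pair_eval n w2 \<omega>))"
    by (auto simp: fun_eq_iff step_def pair_eval_def w1_def w2_def)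
  have "distr forest coupling (pair_eval (Suc n) w) = distr forest (I_space \<Otimes>\<^sub>M I_space) (pair_eval (Suc n) w)"
    by (rule distr_cong) simp_all
  also have "\<dots> = distr (uniform01 \<Otimes>\<^sub>M (coupling \<Otimes>\<^sub>M coupling)) (I_space \<Otimes>\<^sub>M I_space) step"
    unfolding step by (subst distr_distr[OF step_measurable meas, symmetric]) (simp add: triple)
  also have "\<dots> = coupling" using evolved_eq_coupling by (simp add: evolved_def)
  finally show ?case .
qed

text \<open>\<open>sel\<close> will be one of the two projections. Seen through one coordinate
  alone, the forest looks like a trunk of independent \<tau> with independent \<nu>-leaves, just as
  the given process does.\<close>

lemma forest_joint_law:
  assumes sel: "sel \<in> coupling \<rightarrow>\<^sub>M I_space" "distr coupling I_space sel = nu"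
  shows "distr forest ((\<Pi>\<^sub>M i\<in>trunk (Suc n). unit_space) \<Otimes>\<^sub>M (\<Pi>\<^sub>M i\<in>layer (Suc n). I_space))
      (\<lambda>\<omega>. (\<lambda>w\<in>trunk (Suc n). fst (\<omega> w), \<lambda>w\<in>layer (Suc n). sel (snd (\<omega> w))))
    = (\<Pi>\<^sub>M i\<in>trunk (Suc n). uniform01) \<Otimes>\<^sub>M (\<Pi>\<^sub>M i\<in>layer (Suc n). nu)"
proof (rule F.joint_law)
  have ss: "(\<lambda>z. sel (snd z)) \<in> site \<rightarrow>\<^sub>M I_space" by (rule measurable_compose[OF site_snd sel(1)])
  show "(\<lambda>\<omega>. fst (\<omega> w)) \<in> forest \<rightarrow>\<^sub>M unit_space" for w by (rule measurable_compose[OF forest_component site_fst])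
  show "(\<lambda>\<omega>. sel (snd (\<omega> w))) \<in> forest \<rightarrow>\<^sub>M I_space" for w by (rule measurable_compose[OF forest_component ss])
  have "distr forest unit_space (\<lambda>\<omega>. fst (\<omega> w)) = distr (distr forest site (\<lambda>\<omega>. \<omega> w)) unit_space fst" for w
    by (simp add: distr_distr[OF site_fst forest_component] comp_def)
  thus "distr forest unit_space (\<lambda>\<omega>. fst (\<omega> w)) = uniform01" for w by (simp add: distr_forest distr_site_fst)
  have "distr forest I_space (\<lambda>\<omega>. sel (snd (\<omega> w))) = distr (distr (distr forest site (\<lambda>\<omega>. \<omega> w)) coupling snd) I_space sel" for w
    by (simp add: distr_distr[OF site_snd forest_component] distr_distr[OF sel(1) measurable_compose[OF forest_component site_snd]] comp_def)
  thus "distr forest I_space (\<lambda>\<omega>. sel (snd (\<omega> w))) = nu" for w by (simp add: distr_forest distr_site_snd sel)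
  have ind: "F.indep_vars (\<lambda>_. site) (\<lambda>w \<omega>. \<omega> w) UNIV"
    unfolding forest_def by (rule indep_vars_PiM_coordinates[of "\<lambda>_. site"]) (rule prob_space_site)
  show "F.indep_vars (\<lambda>_. unit_space) (\<lambda>w \<omega>. fst (\<omega> w)) UNIV"
    by (rule F.indep_vars_compose2[OF ind site_fst])
  show "F.indep_vars (\<lambda>_. I_space) (\<lambda>w \<omega>. sel (snd (\<omega> w))) (layer (Suc n))"
    by (rule F.indep_vars_subset[OF F.indep_vars_compose2[OF ind ss]]) simp
  fix A B assume A: "A \<in> sets (\<Pi>\<^sub>M i\<in>trunk (Suc n). unit_space)" and B: "B \<in> sets (\<Pi>\<^sub>M i\<in>layer (Suc n). I_space)"
  have d: "trunk (Suc n) \<inter> layer (Suc n) = {}" by (auto simp: trunk_def layer_def)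
  have f: "(\<lambda>\<omega>. \<lambda>w\<in>trunk (Suc n). fst (\<omega> w)) \<in> (\<Pi>\<^sub>M i\<in>trunk (Suc n). site) \<rightarrow>\<^sub>M (\<Pi>\<^sub>M i\<in>trunk (Suc n). unit_space)"
    by (intro measurable_restrict measurable_compose[OF measurable_component_singleton[where M = "\<lambda>_. site"] site_fst])
  have g: "(\<lambda>\<omega>. \<lambda>w\<in>layer (Suc n). sel (snd (\<omega> w))) \<in> (\<Pi>\<^sub>M i\<in>layer (Suc n). site) \<rightarrow>\<^sub>M (\<Pi>\<^sub>M i\<in>layer (Suc n). I_space)"
    by (intro measurable_restrict measurable_compose[OF measurable_component_singleton[where M = "\<lambda>_. site"] ss])
  have r: "(\<lambda>w\<in>trunk (Suc n). fst (restrict \<omega> (trunk (Suc n)) w)) = (\<lambda>w\<in>trunk (Suc n). fst (\<omega> w))"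
    "(\<lambda>w\<in>layer (Suc n). sel (snd (restrict \<omega> (layer (Suc n)) w))) = (\<lambda>w\<in>layer (Suc n). sel (snd (\<omega> w)))" for \<omega>
    by (auto simp: restrict_def)
  show "measure forest ((\<lambda>\<omega>. (\<lambda>w\<in>trunk (Suc n). fst (\<omega> w), \<lambda>w\<in>layer (Suc n). sel (snd (\<omega> w)))) -` (A \<times> B) \<inter> space forest) =
    measure forest ((\<lambda>\<omega>. \<lambda>w\<in>trunk (Suc n). fst (\<omega> w)) -` A \<inter> space forest) *
    measure forest ((\<lambda>\<omega>. \<lambda>w\<in>layer (Suc n). sel (snd (\<omega> w))) -` B \<inter> space forest)"
    using indep_PiM_restrict[of "\<lambda>_. site", OF prob_space_site d f g A B] unfolding r forest_def .
qed (rule trunk_nonempty layer_nonempty)+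

text \<open>When one coordinate is \<infinity> at the root and the other is finite, the common truth
  value of B disagrees with one of them. The off-diagonal event thus lies in the union of two
  mismatch events of equal probability.\<close>

lemma c_le_mismatch:
  assumes B: "B \<in> sets (\<Pi>\<^sub>M i\<in>trunk (Suc n). unit_space)"
  defines "N \<equiv> (\<Pi>\<^sub>M i\<in>trunk (Suc n). uniform01) \<Otimes>\<^sub>M (\<Pi>\<^sub>M i\<in>layer (Suc n). nu)"
  shows "c \<le> 2 * measure N {z\<in>space N. (tree_eval (Suc n) (fst z) (snd z) [] = \<infinity>) \<noteq> (fst z \<in> B)}"
proof -
  have sel: "fst \<in> coupling \<rightarrow>\<^sub>M I_space" "snd \<in> coupling \<rightarrow>\<^sub>M I_space" by simp_all
  define E where "E = (\<lambda>sel. {\<omega>\<in>space forest. (tree_eval (Suc n) (\<lambda>w. fst (\<omega> w)) (\<lambda>w. sel (snd (\<omega> w))) [] = \<infinity>)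
      \<noteq> ((\<lambda>w\<in>trunk (Suc n). fst (\<omega> w)) \<in> B)})"
  have E: "measure forest (E sel) = measure N {z\<in>space N. (tree_eval (Suc n) (fst z) (snd z) [] = \<infinity>) \<noteq> (fst z \<in> B)}"
    "E sel \<in> F.events" if "sel \<in> coupling \<rightarrow>\<^sub>M I_space" "distr coupling I_space sel = nu" for sel
  proof -
    have m: "(\<lambda>\<omega>. fst (\<omega> w)) \<in> forest \<rightarrow>\<^sub>M unit_space" "(\<lambda>\<omega>. sel (snd (\<omega> w))) \<in> forest \<rightarrow>\<^sub>M I_space" for w
      by (rule measurable_compose[OF forest_component site_fst],
          rule measurable_compose[OF forest_component measurable_compose[OF site_snd that(1)]])
    show "measure forest (E sel) = measure N {z\<in>space N. (tree_eval (Suc n) (fst z) (snd z) [] = \<infinity>) \<noteq> (fst z \<in> B)}"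
      unfolding E_def N_def by (rule F.measure_mismatch(1)[OF m forest_joint_law[OF that] B])
    show "E sel \<in> F.events"
      unfolding E_def by (rule F.measure_mismatch(2)[OF m forest_joint_law[OF that] B])
  qed
  have O: "{\<infinity>} \<times> (I_set - {\<infinity>}) \<in> sets coupling"
  proof -
    have "{\<infinity>} \<in> sets I_space" "I_set - {\<infinity>} \<in> sets I_space"
      using I_borel by (auto simp: sets_I_space_iff I_set_def)
    thus ?thesis by auto
  qed
  have pm: "pair_eval (Suc n) [] \<in> forest \<rightarrow>\<^sub>M coupling"
    unfolding forest_def by (rule pair_eval_measurable) simp
  have "c = measure (distr forest coupling (pair_eval (Suc n) [])) ({\<infinity>} \<times> (I_set - {\<infinity>}))"
    by (simp add: distr_pair_eval coupling_off_diagonal)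
  also have "\<dots> = measure forest (pair_eval (Suc n) [] -` ({\<infinity>} \<times> (I_set - {\<infinity>})) \<inter> space forest)"
    by (rule measure_distr[OF pm O])
  also have "\<dots> \<le> measure forest (E fst \<union> E snd)"
    using E(2)[OF sel(1) distr_coupling_fst] E(2)[OF sel(2) distr_coupling_snd]
    by (intro F.finite_measure_mono) (auto simp: E_def pair_eval_def simp del: tree_eval.simps)
  also have "\<dots> \<le> measure forest (E fst) + measure forest (E snd)"
    using E(2)[OF sel(1) distr_coupling_fst] E(2)[OF sel(2) distr_coupling_snd]
    by (rule measure_Un_le)
  also have "\<dots> = 2 * measure N {z\<in>space N. (tree_eval (Suc n) (fst z) (snd z) [] = \<infinity>) \<noteq> (fst z \<in> B)}"
    by (simp add: E(1)[OF sel(1) distr_coupling_fst] E(1)[OF sel(2) distr_coupling_snd])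
  finally show ?thesis .
qed

end

theorem theorem7:
  fixes M :: "'a measure"
    and \<tau> :: "word \<Rightarrow> 'a \<Rightarrow> real"
    and X :: "word \<Rightarrow> 'a \<Rightarrow> ereal"
  assumes "recursive_tree_process M gamma nu \<tau> X"
  shows "\<not> endogenous M \<tau> X"
proof
  assume "endogenous M \<tau> X"
  then obtain F where F: "F \<in> (\<Pi>\<^sub>M i\<in>UNIV. unit_space) \<rightarrow>\<^sub>M I_space"
    and XF: "AE \<omega> in M. X [] \<omega> = F (\<lambda>i. \<tau> i \<omega>)"
    unfolding endogenous_def by blast
  note rtp = assms[unfolded recursive_tree_process_def]
  interpret prob_space M using rtp by blast
  obtain c \<kappa> \<phi> where "profile c \<kappa> \<phi>" using profile_exists by blast
  then interpret profile c \<kappa> \<phi> .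
  have \<tau>: "\<tau> i \<in> M \<rightarrow>\<^sub>M unit_space" and X: "X i \<in> M \<rightarrow>\<^sub>M I_space" for i using rtp by blast+
  have \<tau>_all: "(\<lambda>\<omega> i. \<tau> i \<omega>) \<in> M \<rightarrow>\<^sub>M (\<Pi>\<^sub>M i\<in>UNIV. unit_space)"
    using measurable_restrict[of UNIV \<tau> M "\<lambda>_. unit_space", OF \<tau>] unfolding restrict_UNIV .
  \<comment> \<open>Countability of the set of words merges the exceptional null sets into
    one.\<close>
  have recursion: "AE \<omega> in M. \<forall>i. X i \<omega> = gamma (\<tau> i \<omega>) (X (i @ [Letter1]) \<omega>) (X (i @ [Letter2]) \<omega>)"
    using rtp by (subst AE_all_countable) blast
  have eval: "tree_eval n (\<lambda>w. \<tau> w \<omega>) (\<lambda>w. X w \<omega>) w = X w \<omega>"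
    if "\<forall>i. X i \<omega> = gamma (\<tau> i \<omega>) (X (i @ [Letter1]) \<omega>) (X (i @ [Letter2]) \<omega>)" for n w \<omega>
    by (induction n arbitrary: w) (simp_all add: that[rule_format, symmetric])
  have law: "distr M ((\<Pi>\<^sub>M i\<in>trunk (Suc n). unit_space) \<Otimes>\<^sub>M (\<Pi>\<^sub>M i\<in>layer (Suc n). I_space))
      (\<lambda>\<omega>. (\<lambda>w\<in>trunk (Suc n). \<tau> w \<omega>, \<lambda>w\<in>layer (Suc n). X w \<omega>))
    = (\<Pi>\<^sub>M i\<in>trunk (Suc n). uniform01) \<Otimes>\<^sub>M (\<Pi>\<^sub>M i\<in>layer (Suc n). nu)" for n
  proof -
    have b: "indep_vars (\<lambda>_. I_space) X (layer (Suc n))"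
      "\<forall>i\<in>layer (Suc n). distr M I_space (X i) = nu"
      "indep_set (sets (vimage_algebra (space M) (\<lambda>\<omega>. \<lambda>i\<in>layer (Suc n). X i \<omega>) (\<Pi>\<^sub>M i\<in>layer (Suc n). I_space)))
         (sets (vimage_algebra (space M) (\<lambda>\<omega>. \<lambda>i\<in>trunk (Suc n). \<tau> i \<omega>) (\<Pi>\<^sub>M i\<in>trunk (Suc n). unit_space)))"
      using rtp finite_trunk[of "Suc n"] rooted_subtree_trunk[of "Suc n"]
      unfolding boundary_trunk[symmetric] by blast+
    show ?thesis
    proof (rule joint_law)
      fix A B assume A: "A \<in> sets (\<Pi>\<^sub>M i\<in>trunk (Suc n). unit_space)" and B: "B \<in> sets (\<Pi>\<^sub>M i\<in>layer (Suc n). I_space)"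
      have "prob (((\<lambda>\<omega>. \<lambda>w\<in>layer (Suc n). X w \<omega>) -` B \<inter> space M) \<inter> ((\<lambda>\<omega>. \<lambda>w\<in>trunk (Suc n). \<tau> w \<omega>) -` A \<inter> space M))
        = prob ((\<lambda>\<omega>. \<lambda>w\<in>layer (Suc n). X w \<omega>) -` B \<inter> space M) * prob ((\<lambda>\<omega>. \<lambda>w\<in>trunk (Suc n). \<tau> w \<omega>) -` A \<inter> space M)"
        by (rule indep_setD[OF b(3)]) (rule in_vimage_algebra[OF B] in_vimage_algebra[OF A])+
      moreover have "((\<lambda>\<omega>. \<lambda>w\<in>layer (Suc n). X w \<omega>) -` B \<inter> space M) \<inter> ((\<lambda>\<omega>. \<lambda>w\<in>trunk (Suc n). \<tau> w \<omega>) -` A \<inter> space M)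
        = (\<lambda>\<omega>. (\<lambda>w\<in>trunk (Suc n). \<tau> w \<omega>, \<lambda>w\<in>layer (Suc n). X w \<omega>)) -` (A \<times> B) \<inter> space M" by auto
      ultimately show "prob ((\<lambda>\<omega>. (\<lambda>w\<in>trunk (Suc n). \<tau> w \<omega>, \<lambda>w\<in>layer (Suc n). X w \<omega>)) -` (A \<times> B) \<inter> space M) =
        prob ((\<lambda>\<omega>. \<lambda>w\<in>trunk (Suc n). \<tau> w \<omega>) -` A \<inter> space M) * prob ((\<lambda>\<omega>. \<lambda>w\<in>layer (Suc n). X w \<omega>) -` B \<inter> space M)"
        by simp
    qed (use rtp b in \<open>auto simp: trunk_nonempty layer_nonempty\<close>)
  qed
  define S where "S = F -` {\<infinity>} \<inter> space (\<Pi>\<^sub>M i\<in>UNIV. unit_space)"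
  define Q where "Q = distr M (\<Pi>\<^sub>M i\<in>(UNIV :: word set). unit_space) (\<lambda>\<omega> i. \<tau> i \<omega>)"
  have inf: "{\<infinity>} \<in> sets I_space" by (auto simp: sets_I_space_iff I_set_def)
  have S: "S \<in> sets (\<Pi>\<^sub>M i\<in>UNIV. unit_space)" unfolding S_def by (rule measurable_sets[OF F inf])
  \<comment> \<open>The tolerance is c/2 because two equally likely mismatch events together must
    have probability at least c.\<close>
  have "\<exists>n. \<exists>B\<in>sets (\<Pi>\<^sub>M i\<in>trunk (Suc n). unit_space).
      measure Q {\<omega>\<in>space Q. (\<omega> \<in> S) \<noteq> (restrict \<omega> (trunk (Suc n)) \<in> B)} < c / 2"
  proof (rule cylinder_approximation)
    show "prob_space Q" unfolding Q_def by (rule prob_space_distr[OF \<tau>_all])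
    show "incseq (\<lambda>n. trunk (Suc n))" by (auto simp: incseq_def trunk_def)
    show "(\<Union>n. trunk (Suc n)) = UNIV" by (auto simp: trunk_def intro: exI[of _ "length _"])
  qed (use S c_pos in \<open>simp_all add: Q_def\<close>)
  then obtain n B where B: "B \<in> sets (\<Pi>\<^sub>M i\<in>trunk (Suc n). unit_space)"
    and less: "measure Q {\<omega>\<in>space Q. (\<omega> \<in> S) \<noteq> (restrict \<omega> (trunk (Suc n)) \<in> B)} < c / 2" by blast
  let ?E = "{\<omega>\<in>space M. (tree_eval (Suc n) (\<lambda>w. \<tau> w \<omega>) (\<lambda>w. X w \<omega>) [] = \<infinity>) \<noteq> ((\<lambda>w\<in>trunk (Suc n). \<tau> w \<omega>) \<in> B)}"
  let ?E' = "{\<omega>\<in>space M. ((\<lambda>i. \<tau> i \<omega>) \<in> S) \<noteq> ((\<lambda>w\<in>trunk (Suc n). \<tau> w \<omega>) \<in> B)}"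
  have D: "{\<omega>\<in>space Q. (\<omega> \<in> S) \<noteq> (restrict \<omega> (trunk (Suc n)) \<in> B)} \<in> sets (\<Pi>\<^sub>M i\<in>UNIV. unit_space)"
  proof -
    have "(\<lambda>\<omega>. restrict \<omega> (trunk (Suc n))) \<in> (\<Pi>\<^sub>M i\<in>UNIV. unit_space) \<rightarrow>\<^sub>M (\<Pi>\<^sub>M i\<in>trunk (Suc n). unit_space)"
      by (rule measurable_restrict_subset) simp
    note [measurable] = this B S
    show ?thesis unfolding Q_def space_distr by measurable
  qed
  have pre: "(\<lambda>\<omega> i. \<tau> i \<omega>) -` {\<omega>\<in>space Q. (\<omega> \<in> S) \<noteq> (restrict \<omega> (trunk (Suc n)) \<in> B)} \<inter> space M = ?E'"
    using measurable_space[OF \<tau>_all] by (auto simp: Q_def)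
  have "?E' \<in> events" using measurable_sets[OF \<tau>_all D] unfolding pre .
  moreover have "?E \<in> events" by (rule measure_mismatch(2)[OF \<tau> X law B])
  \<comment> \<open>Here endogeny meets the recursion: the truncated tree with the true leaves
    reproduces the root, and the root is the function \<open>F\<close> of \<tau>.\<close>
  moreover have "AE \<omega> in M. \<omega> \<in> ?E \<longleftrightarrow> \<omega> \<in> ?E'"
    using recursion XF
  proof eventually_elim
    case (elim \<omega>)
    have "tree_eval (Suc n) (\<lambda>w. \<tau> w \<omega>) (\<lambda>w. X w \<omega>) [] = F (\<lambda>i. \<tau> i \<omega>)"
      using eval[OF elim(1), of "Suc n" "[]"] elim(2) by simp
    thus ?case using measurable_space[OF \<tau>_all, of \<omega>] by (auto simp: S_def simp del: tree_eval.simps)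
  qed
  ultimately have "prob ?E = prob ?E'" by (intro finite_measure_eq_AE) auto
  also have "\<dots> < c / 2"
    using less unfolding pre[symmetric] by (subst (asm) Q_def) (simp only: measure_distr[OF \<tau>_all D])
  finally have "prob ?E < c / 2" .
  moreover have "c \<le> 2 * prob ?E"
    unfolding measure_mismatch(1)[OF \<tau> X law B] by (rule c_le_mismatch[OF B])
  ultimately show False by simp
qed

end
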